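(* Let $G \subset GL(n,\mathbb{R})$ be a real algebraic group that is reductive, with Iwasawa decomposition $G = KAN$. Let $\mathfrak{u} \subset \mathrm{Lie}(G)$ be a subalgebra in which every element is nilpotent, and let $U$ be the (connected) subgroup of $G$ whose Lie algebra is $\mathfrak{u}$. Then $U$ is conjugate in $G$ to a subgroup of $N$; that is, there exists $g \in G$ with $g^{-1}Ug \subset N$. In particular, all maximal unipotent subgroups of $G$ are conjugate in $G$.
   Context: A real algebraic group is a closed connected subgroup $G$ of $GL(n,\mathbb{R})$ such that the connected subgroup $G^{\mathbb{C}}$ of $GL(n,\mathbb{C})$ with Lie algebra $\mathrm{Lie}(G) + i\,\mathrm{Lie}(G) \subset \mathfrak{gl}(n,\mathbb{C})$ is an affine algebraic subgroup of $GL(n,\mathbb{C})$; here $\mathrm{Lie}(G)$ is the Lie algebra of $G$. It is reductive if $G^{\mathbb{C}}$ is a reductive algebraic group. Elements of $\mathrm{Lie}(G) \subset \mathfrak{gl}(n,\mathbb{R})$ are called nilpotent if they are nilpotent as matrices; a subgroup of $G$ is unipotent if all its elements are unipotent matrices, and a maximal unipotent subgroup is a unipotent subgroup maximal under inclusion. Iwasawa decomposition $G = KAN$ has its usual meaning: after conjugating $G$ in $GL(n,\mathbb{R})$ so that $G$ is stable under transpose, $K = G \cap O(n)$ is a maximal compact subgroup; $\mathfrak{p}$ is the space of symmetric matrices in $\mathrm{Lie}(G)$; $\mathfrak{a}$ is a maximal abelian subspace of $\mathfrak{p}$ and $A = \exp(\mathfrak{a})$; $\mathfrak{n}$ is the sum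 of the root spaces of $\mathrm{ad}(\mathfrak{a})$ on $\mathrm{Lie}(G)$ for a choice of positive restricted roots, and $N = \exp(\mathfrak{n})$. *)

theory Defs
  imports "HOL-Analysis.Analysis" "HOL-Algebra.Generated_Groups"
begin

section \<open>Matrix groups\<close>

definition GL_group :: "('a::field ^ 'n ^ 'n) monoid" where
  "GL_group = \<lparr>carrier = {A. invertible A}, mult = (**), one = mat 1\<rparr>"

definition conj_set :: "'a::field ^ 'n ^ 'n \<Rightarrow> ('a ^ 'n ^ 'n) set \<Rightarrow> ('a ^ 'n ^ 'n) set" where
  "conj_set g S = (\<lambda>x. g ** x ** matrix_inv g) ` S"

primrec mat_pow :: "'a::semiring_1 ^ 'n ^ 'n \<Rightarrow> nat \<Rightarrow> 'a ^ 'n ^ 'n" where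
  "mat_pow A 0 = mat 1"
| "mat_pow A (Suc k) = A ** mat_pow A k"

definition nilpotent_mat :: "'a::semiring_1 ^ 'n ^ 'n \<Rightarrow> bool" where
  "nilpotent_mat A \<longleftrightarrow> (\<exists>k. mat_pow A k = 0)"

definition unipotent_mat :: "'a::ring_1 ^ 'n ^ 'n \<Rightarrow> bool" where
  "unipotent_mat A \<longleftrightarrow> nilpotent_mat (A - mat 1)"

(* The library function exp does not apply here: the type of square matrices carries the
   componentwise product, so it is not a normed algebra under **. *)
definition mat_exp :: "'a::real_normed_field ^ 'n ^ 'n \<Rightarrow> 'a ^ 'n ^ 'n" where
  "mat_exp A = (\<Sum>k. (1 / fact k) *\<^sub>R mat_pow A k)"

section \<open>Lie algebras of matrices\<close>

definition lie_bracket :: "'a::ring_1 ^ 'n ^ 'n \<Rightarrow> 'a ^ 'n ^ 'n \<Rightarrow> 'a ^ 'n ^ 'n" where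
  "lie_bracket X Y = X ** Y - Y ** X"

definition lie_subalgebra :: "(real ^ 'n ^ 'n) set \<Rightarrow> (real ^ 'n ^ 'n) set \<Rightarrow> bool" where
  "lie_subalgebra h g \<longleftrightarrow>
     subspace h \<and> h \<subseteq> g \<and> (\<forall>X\<in>h. \<forall>Y\<in>h. lie_bracket X Y \<in> h)"

(* The Lie algebra of a closed subgroup of GL(n,R). *)
definition Lie :: "(real ^ 'n ^ 'n) set \<Rightarrow> (real ^ 'n ^ 'n) set" where
  "Lie G = {X. \<forall>t::real. mat_exp (t *\<^sub>R X) \<in> G}"

(* The connected (not necessarily closed) Lie subgroup of the general linear group whose Lie
   algebra is h is the abstract subgroup generated by exp(h). *)
definition connected_subgroup ::
    "('a::real_normed_field ^ 'n ^ 'n) set \<Rightarrow> ('a ^ 'n ^ 'n) set" where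
  "connected_subgroup h = generate GL_group (mat_exp ` h)"

definition complexify_lie :: "(real ^ 'n ^ 'n) set \<Rightarrow> (complex ^ 'n ^ 'n) set" where
  "complexify_lie g = {\<chi> i j. complex_of_real (X $ i $ j) + \<i> * complex_of_real (Y $ i $ j) |
                         X Y. X \<in> g \<and> Y \<in> g}"

definition complexification :: "(real ^ 'n ^ 'n) set \<Rightarrow> (complex ^ 'n ^ 'n) set" where
  "complexification G = connected_subgroup (complexify_lie (Lie G))"

section \<open>Complex affine algebraic groups\<close>

inductive matrix_polynomial :: "(complex ^ 'n ^ 'n \<Rightarrow> complex) \<Rightarrow> bool" where
  const: "matrix_polynomial (\<lambda>A. c)"
| entry: "matrix_polynomial (\<lambda>A. A $ i $ j)"
| add: "matrix_polynomial p \<Longrightarrow> matrix_polynomial q \<Longrightarrow> matrix_polynomial (\<lambda>A. p A + q A)"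
| mult: "matrix_polynomial p \<Longrightarrow> matrix_polynomial q \<Longrightarrow> matrix_polynomial (\<lambda>A. p A * q A)"

(* Regular functions on GL(n,C) are polynomials in the entries and 1/det; multiplying by a power
   of det shows that polynomials in the entries alone already cut out all closed subsets. *)
definition zariski_closed :: "(complex ^ 'n ^ 'n) set \<Rightarrow> bool" where
  "zariski_closed Z \<longleftrightarrow>
     (\<exists>F. (\<forall>p\<in>F. matrix_polynomial p) \<and> Z = {A. invertible A \<and> (\<forall>p\<in>F. p A = 0)})"

definition zariski_connected :: "(complex ^ 'n ^ 'n) set \<Rightarrow> bool" where
  "zariski_connected S \<longleftrightarrow>
     \<not> (\<exists>Z1 Z2. zariski_closed Z1 \<and> zariski_closed Z2 \<and> S \<subseteq> Z1 \<union> Z2 \<and>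
          S \<inter> Z1 \<inter> Z2 = {} \<and> S \<inter> Z1 \<noteq> {} \<and> S \<inter> Z2 \<noteq> {})"

definition affine_algebraic_group :: "(complex ^ 'n ^ 'n) set \<Rightarrow> bool" where
  "affine_algebraic_group H \<longleftrightarrow> subgroup H GL_group \<and> zariski_closed H"

(* Reductive: the unipotent radical, i.e. the largest closed connected normal unipotent
   subgroup, is trivial. *)
definition reductive_algebraic_group :: "(complex ^ 'n ^ 'n) set \<Rightarrow> bool" where
  "reductive_algebraic_group H \<longleftrightarrow>
     affine_algebraic_group H \<and>
     (\<forall>R. affine_algebraic_group R \<and> zariski_connected R \<and>
          R \<lhd> GL_group\<lparr>carrier := H\<rparr> \<and> (\<forall>x\<in>R. unipotent_mat x) \<longrightarrow> R = {mat 1})"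

section \<open>Real algebraic groups\<close>

definition real_algebraic_group :: "(real ^ 'n ^ 'n) set \<Rightarrow> bool" where
  "real_algebraic_group G \<longleftrightarrow>
     subgroup G GL_group \<and>
     closedin (top_of_set (carrier GL_group)) G \<and>
     connected G \<and>
     affine_algebraic_group (complexification G)"

definition reductive_real_group :: "(real ^ 'n ^ 'n) set \<Rightarrow> bool" where
  "reductive_real_group G \<longleftrightarrow>
     real_algebraic_group G \<and> reductive_algebraic_group (complexification G)"

definition unipotent_subgroup :: "(real ^ 'n ^ 'n) set \<Rightarrow> (real ^ 'n ^ 'n) set \<Rightarrow> bool" where
  "unipotent_subgroup G V \<longleftrightarrow>
     subgroup V GL_group \<and> V \<subseteq> G \<and> (\<forall>x\<in>V. unipotent_mat x)"

definition maximal_unipotent_subgroup ::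
    "(real ^ 'n ^ 'n) set \<Rightarrow> (real ^ 'n ^ 'n) set \<Rightarrow> bool" where
  "maximal_unipotent_subgroup G V \<longleftrightarrow>
     unipotent_subgroup G V \<and> (\<forall>W. unipotent_subgroup G W \<and> V \<subseteq> W \<longrightarrow> W = V)"

section \<open>Iwasawa decomposition\<close>

definition abelian_subspace :: "(real ^ 'n ^ 'n) set \<Rightarrow> bool" where
  "abelian_subspace a \<longleftrightarrow> subspace a \<and> (\<forall>X\<in>a. \<forall>Y\<in>a. lie_bracket X Y = 0)"

definition maximal_abelian_in :: "(real ^ 'n ^ 'n) set \<Rightarrow> (real ^ 'n ^ 'n) set \<Rightarrow> bool" where
  "maximal_abelian_in p a \<longleftrightarrow>
     abelian_subspace a \<and> a \<subseteq> p \<and>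
     (\<forall>b. abelian_subspace b \<and> b \<subseteq> p \<and> a \<subseteq> b \<longrightarrow> b = a)"

definition root_space ::
    "(real ^ 'n ^ 'n) set \<Rightarrow> (real ^ 'n ^ 'n) set \<Rightarrow> (real ^ 'n ^ 'n \<Rightarrow> real) \<Rightarrow>
     (real ^ 'n ^ 'n) set" where
  "root_space g a \<alpha> = {X \<in> g. \<forall>H\<in>a. lie_bracket H X = \<alpha> H *\<^sub>R X}"

(* A functional on a is represented by any of its linear extensions to all matrices; everything
   below depends only on its restriction to a. *)
definition restricted_roots ::
    "(real ^ 'n ^ 'n) set \<Rightarrow> (real ^ 'n ^ 'n) set \<Rightarrow> (real ^ 'n ^ 'n \<Rightarrow> real) set" where
  "restricted_roots g a =
     {\<alpha>. linear \<alpha> \<and> (\<exists>H\<in>a. \<alpha> H \<noteq> 0) \<and> root_space g a \<alpha> \<noteq> {0}}"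

(* A choice of positive roots is given by a Weyl chamber, i.e. by a regular element of a. *)
definition positive_restricted_roots ::
    "(real ^ 'n ^ 'n) set \<Rightarrow> (real ^ 'n ^ 'n) set \<Rightarrow> (real ^ 'n ^ 'n \<Rightarrow> real) set \<Rightarrow> bool"
  where
  "positive_restricted_roots g a P \<longleftrightarrow>
     (\<exists>H\<in>a. (\<forall>\<alpha>\<in>restricted_roots g a. \<alpha> H \<noteq> 0) \<and>
            P = {\<alpha> \<in> restricted_roots g a. \<alpha> H > 0})"

definition Iwasawa_self_adjoint ::
    "(real ^ 'n ^ 'n) set \<Rightarrow> (real ^ 'n ^ 'n) set \<Rightarrow> (real ^ 'n ^ 'n) set \<Rightarrow>
     (real ^ 'n ^ 'n) set \<Rightarrow> bool" where
  "Iwasawa_self_adjoint G K A N \<longleftrightarrow>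
     transpose ` G = G \<and>
     K = G \<inter> {x. orthogonal_matrix x} \<and>
     (\<exists>a P. maximal_abelian_in {X \<in> Lie G. transpose X = X} a \<and>
            A = mat_exp ` a \<and>
            positive_restricted_roots (Lie G) a P \<and>
            N = mat_exp ` span (\<Union>\<alpha>\<in>P. root_space (Lie G) a \<alpha>)) \<and>
     G = {k ** x ** u | k x u. k \<in> K \<and> x \<in> A \<and> u \<in> N}"

definition Iwasawa_decomposition ::
    "(real ^ 'n ^ 'n) set \<Rightarrow> (real ^ 'n ^ 'n) set \<Rightarrow> (real ^ 'n ^ 'n) set \<Rightarrow>
     (real ^ 'n ^ 'n) set \<Rightarrow> bool" where
  "Iwasawa_decomposition G K A N \<longleftrightarrow>
     (\<exists>h. invertible h \<and>
          Iwasawa_self_adjoint (conj_set h G) (conj_set h K) (conj_set h A) (conj_set h N))"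

end

theory Submission
  imports Defs
begin

text \<open>Let H be the regular element of the Lie algebra of A that defines the positive roots, and let
  ad H grade all matrices; the sum of the nonnegative eigenspaces is an associative algebra P that
  contains A and N. A unipotent group V acts on the compact set of subspaces k P, with k in K,
  because G = KAN, and it fixes one of them, so after conjugation by k it lies in P. An element
  kan of G in P has k commuting with H, since the inverse of k is its transpose. If it is also
  unipotent then so is ka; applying G = KAN to the conjugates of A by k shows that k normalises
  the commuting squares of elements of A, which makes a power of ka normal, so ka = 1 and the
  element lies in N. Kolchin's theorem supplies the filtration used for the fixed point, and
  Engel's theorem shows that the connected subgroup of a nilpotent subalgebra is unipotent.\<close>

section \<open>The algebra of real square matrices\<close>

text \<open>This is a real counterpart of Borel's fixed point theorem. The flag variety is replaced
  by the orbit of \<open>P\<close> under left multiplication by \<open>K\<close>, inside the space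
  of matrices. Since \<open>P\<close> contains the identity, g P = P forces g to lie in
  \<open>P\<close>; so a subspace k P fixed by the group puts its conjugate by k into
  \<open>P\<close>. Completeness is replaced by compactness of \<open>K\<close> and by growth: the
  j-th powers of a unipotent matrix are polynomial in j, so an orbit that is bounded infinitely
  often is constant. The other obstacle is the factor ka of a unipotent element of \<open>P\<close>.
  Symmetric matrices that commute with a given one and have their eigenvalues in its finite spectrum
  cannot be arbitrarily close to it without being equal to it. Hence the conjugates of the square of
  a by powers of k, which stay in a compact set, return exactly, and the period is the exponent for
  which the power of ka is normal. Nilpotency is detected by traces of powers and eigenvectors are
  found by maximising a norm, so neither complexification nor Jordan form enters.\<close>

lemma inner_matrix_eq_trace: "(A::real^'n^'n) \<bullet> B = trace (transpose A ** B)"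
proof -
  have "A \<bullet> B = (\<Sum>j\<in>UNIV. \<Sum>i\<in>UNIV. A $ j $ i * B $ j $ i)"
    by (simp add: inner_vec_def)
  also have "\<dots> = (\<Sum>i\<in>UNIV. \<Sum>j\<in>UNIV. A $ j $ i * B $ j $ i)"
    by (rule sum.swap)
  finally show ?thesis
    by (simp add: trace_def transpose_def matrix_matrix_mult_def)
qed

lemma norm_matrix_mult_le: "norm ((A::real^'n^'n) ** (B::real^'n^'n)) \<le> norm A * norm B"
proof -
  have sq: "(norm M)\<^sup>2 = (\<Sum>i\<in>UNIV. \<Sum>j\<in>UNIV. (M $ i $ j)\<^sup>2)" for M :: "real^'n^'n"
    unfolding power2_norm_eq_inner by (simp add: inner_vec_def power2_eq_square)
  have entry: "((A ** B) $ i $ j)\<^sup>2 \<le> (\<Sum>k\<in>UNIV. (A $ i $ k)\<^sup>2) * (\<Sum>k\<in>UNIV. (B $ k $ j)\<^sup>2)" for i j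
    unfolding matrix_matrix_mult_def by (simp add: Cauchy_Schwarz_ineq_sum)
  have "(norm (A ** B))\<^sup>2 \<le> (\<Sum>i\<in>UNIV. \<Sum>j\<in>UNIV. (\<Sum>k\<in>UNIV. (A $ i $ k)\<^sup>2) * (\<Sum>k\<in>UNIV. (B $ k $ j)\<^sup>2))"
    unfolding sq by (intro sum_mono entry)
  also have "\<dots> = (\<Sum>i\<in>UNIV. \<Sum>k\<in>UNIV. (A $ i $ k)\<^sup>2) * (\<Sum>j\<in>UNIV. \<Sum>k\<in>UNIV. (B $ k $ j)\<^sup>2)"
    by (simp add: sum_product)
  also have "(\<Sum>j\<in>UNIV. \<Sum>k\<in>UNIV. (B $ k $ j)\<^sup>2) = (\<Sum>k\<in>UNIV. \<Sum>j\<in>UNIV. (B $ k $ j)\<^sup>2)"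
    by (rule sum.swap)
  finally have "(norm (A ** B))\<^sup>2 \<le> (norm A * norm B)\<^sup>2"
    by (simp add: sq power_mult_distrib)
  then show ?thesis
    by (rule power2_le_imp_le) simp
qed

lemma bounded_bilinear_matrix_mult:
  "bounded_bilinear ((**) :: real^'n^'n \<Rightarrow> real^'n^'n \<Rightarrow> real^'n^'n)"
proof
  show "\<exists>K. \<forall>a b. norm ((a::real^'n^'n) ** (b::real^'n^'n)) \<le> norm a * norm b * K"
    by (rule exI[of _ 1]) (simp add: norm_matrix_mult_le)
qed (simp_all add: vec_eq_iff matrix_matrix_mult_def algebra_simps sum.distrib sum_distrib_left)

interpretation mm: bounded_bilinear "(**) :: real^'n^'n \<Rightarrow> real^'n^'n \<Rightarrow> real^'n^'n"
  by (rule bounded_bilinear_matrix_mult)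

lemma linear_transpose: "linear (transpose :: real^'n^'n \<Rightarrow> real^'n^'n)"
  by (intro linearI) (simp_all add: transpose_def vec_eq_iff)

lemmas transpose_add = linear_add[OF linear_transpose]
  and transpose_diff = linear_diff[OF linear_transpose]

lemma linear_trace: "linear (trace :: real^'n^'n \<Rightarrow> real)"
  by (intro linearI) (simp_all add: trace_def sum.distrib sum_distrib_left)

lemma norm_orthogonal_matrix_mult:
  fixes k Y :: "real^'n^'n"
  assumes "orthogonal_matrix k"
  shows "norm (k ** Y) = norm Y"
proof -
  have "(k ** Y) \<bullet> (k ** Y) = trace (transpose Y ** (transpose k ** k) ** Y)"
    by (simp only: inner_matrix_eq_trace matrix_transpose_mul matrix_mul_assoc)
  also have "\<dots> = Y \<bullet> Y"
    using assms by (simp add: orthogonal_matrix_def inner_matrix_eq_trace)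
  finally show ?thesis
    by (simp add: norm_eq_sqrt_inner)
qed

lemma norm_orthogonal_matrix_mult_right:
  fixes k Y :: "real^'n^'n"
  assumes "orthogonal_matrix k"
  shows "norm (Y ** k) = norm Y"
proof -
  have t: "norm (transpose M) = norm M" for M :: "real^'n^'n"
    using trace_mul_sym[of "transpose M" M]
    by (simp add: norm_eq_sqrt_inner inner_matrix_eq_trace)
  have "norm (Y ** k) = norm (transpose k ** transpose Y)"
    by (metis t matrix_transpose_mul)
  then show ?thesis
    using assms by (simp add: norm_orthogonal_matrix_mult t)
qed

lemma invertible_mult_cancel_left:
  fixes g X Y :: "real^'n^'n"
  assumes "invertible g" "g ** X = g ** Y"
  shows "X = Y"
  by (metis assms invertible_def matrix_mul_assoc matrix_mul_lid)

lemma invertible_mult_cancel_right: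
  fixes g X Y :: "real^'n^'n"
  assumes "invertible g" "X ** g = Y ** g"
  shows "X = Y"
  by (metis assms invertible_def matrix_mul_assoc matrix_mul_rid)

lemma matrix_inv_mult:
  fixes g :: "'a::semiring_1^'n^'n"
  assumes "invertible g"
  shows "g ** matrix_inv g = mat 1" "matrix_inv g ** g = mat 1"
  using someI_ex[OF assms[unfolded invertible_def]] unfolding matrix_inv_def by auto

lemma matrix_inv_unique':
  fixes g h :: "real^'n^'n"
  assumes "g ** h = mat 1"
  shows "matrix_inv g = h" "invertible g" "invertible h"
proof -
  have "h ** g = mat 1" using assms by (simp add: matrix_left_right_inverse)
  then show "invertible g" "invertible h" using assms unfolding invertible_def by auto
  then show "matrix_inv g = h" using assms
    by (metis invertible_mult_cancel_left matrix_inv_mult(1))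
qed

text \<open>Left multiplication by \<open>g\<close> is injective on the finite-dimensional
  \<open>P\<close>, so it maps \<open>P\<close> onto itself. This replaces any formula for the
  inverse.\<close>

lemma inverse_preserves_subspace:
  fixes P :: "(real^'n^'n) set" and g h :: "real^'n^'n"
  assumes "subspace P" "invertible g" "\<And>Y. Y \<in> P \<Longrightarrow> g ** Y \<in> P" "h ** g = mat 1" "Y \<in> P"
  shows "h ** Y \<in> P"
proof -
  have lin: "linear ((**) g :: real^'n^'n \<Rightarrow> real^'n^'n)"
    by (rule bounded_linear.linear[OF mm.bounded_linear_right])
  have inj: "inj ((**) g :: real^'n^'n \<Rightarrow> real^'n^'n)"
    using assms(2) invertible_mult_cancel_left by (blast intro: injI)
  have "(**) g ` P = P"
  proof (rule subspace_dim_equal)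
    show "dim P \<le> dim ((**) g ` P)"
      using dim_image_eq[OF lin] inj by (metis inj_on_subset order_refl subset_UNIV)
  qed (use assms linear_subspace_image[OF lin] in auto)
  then obtain Z where "Z \<in> P" "Y = g ** Z" using assms(5) by blast
  then show ?thesis using assms(4) by (simp add: matrix_mul_assoc)
qed

text \<open>\<open>q\<close> is the orthogonal projection onto the complement of \<open>E\<close>.
  It serves as the quotient map modulo \<open>E\<close>, with values in the same space and without
  increasing norms.\<close>

lemma exists_linear_with_kernel:
  fixes E :: "'a::euclidean_space set"
  assumes "subspace E"
  obtains q :: "'a \<Rightarrow> 'a" where "linear q" "\<And>z. q z = 0 \<longleftrightarrow> z \<in> E" "\<And>z. norm (q z) \<le> norm z"
    "\<And>z. z - q z \<in> E" "\<And>z w. w \<in> E \<Longrightarrow> q z \<bullet> w = 0"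
proof -
  obtain B where B: "B \<subseteq> E" "pairwise orthogonal B" "\<And>x. x \<in> B \<Longrightarrow> norm x = 1"
    "independent B" "card B = dim E" "span B = E"
    using orthonormal_basis_subspace[OF assms] by metis
  have fin: "finite B" using B(4) by (rule independent_imp_finite)
  define p where "p z = (\<Sum>b\<in>B. (z \<bullet> b) *\<^sub>R b)" for z
  have linp: "linear p"
    unfolding p_def by (intro linearI) (simp_all add: inner_add_left scaleR_add_left sum.distrib scaleR_sum_right)
  have pE: "p z \<in> E" for z
    unfolding p_def using B(1) assms by (auto intro!: subspace_sum subspace_scale)
  have orthB: "(z - p z) \<bullet> b = 0" if "b \<in> B" for z b
  proof -
    have "p z \<bullet> b = (\<Sum>c\<in>B. if c = b then z \<bullet> b else 0)"
      unfolding p_def inner_sum_left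
    proof (rule sum.cong)
      fix c assume "c \<in> B"
      then show "(z \<bullet> c) *\<^sub>R c \<bullet> b = (if c = b then z \<bullet> b else 0)"
        using B(2,3) that by (auto simp: pairwise_def orthogonal_def norm_eq_1)
    qed simp
    also have "\<dots> = z \<bullet> b" using that fin by simp
    finally show ?thesis by (simp add: inner_diff_left)
  qed
  have orth: "(z - p z) \<bullet> w = 0" if "w \<in> E" for z w
  proof -
    have "w \<in> span B" using that B(6) by simp
    then show ?thesis
      by (induction rule: span_induct_alt) (simp_all add: inner_add_right orthB)
  qed
  have fixp: "p z = z" if "z \<in> E" for z
  proof -
    have "(z - p z) \<bullet> (z - p z) = 0" using that pE by (simp add: orth assms subspace_diff)
    then show ?thesis by simp
  qed
  show ?thesis
  proof (rule that[of "\<lambda>z. z - p z"])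
    show "linear (\<lambda>z. z - p z)" using linp by (intro linear_compose_sub linear_id[unfolded id_def])
    show "(z - p z = 0) = (z \<in> E)" for z using fixp pE by (metis eq_iff_diff_eq_0)
    show "norm (z - p z) \<le> norm z" for z
    proof -
      have "(norm z)\<^sup>2 = (norm (z - p z))\<^sup>2 + (norm (p z))\<^sup>2"
        using orth[OF pE, of z z]
        by (simp add: power2_norm_eq_inner inner_diff_left inner_diff_right inner_commute)
      then have "(norm (z - p z))\<^sup>2 \<le> (norm z)\<^sup>2" by simp
      then show ?thesis by (rule power2_le_imp_le) simp
    qed
    show "z - (z - p z) \<in> E" for z using pE by simp
    show "(z - p z) \<bullet> w = 0" if "w \<in> E" for z w using orth that .
  qed
qed

subsection \<open>Powers and exponentials\<close>

lemma mat_pow_add: "mat_pow (A::'a::semiring_1^'n^'n) (i + j) = mat_pow A i ** mat_pow A j"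
  by (induction i) (simp_all add: matrix_mul_assoc)

lemma mat_pow_Suc_right: "mat_pow (A::'a::semiring_1^'n^'n) (Suc k) = mat_pow A k ** A"
  using mat_pow_add[of A k 1] by simp

lemma mat_pow_mult: "mat_pow (A::'a::semiring_1^'n^'n) (i * j) = mat_pow (mat_pow A i) j"
  by (induction j) (simp_all add: mat_pow_add)

lemma mat_pow_commute:
  "A ** B = B ** A \<Longrightarrow> mat_pow (A::'a::semiring_1^'n^'n) k ** B = B ** mat_pow A k"
proof (induction k)
  case (Suc k)
  have "mat_pow A (Suc k) ** B = A ** (mat_pow A k ** B)" by (simp add: matrix_mul_assoc)
  also have "\<dots> = (A ** B) ** mat_pow A k" using Suc by (simp add: matrix_mul_assoc)
  also have "\<dots> = B ** mat_pow A (Suc k)" using Suc by (simp add: matrix_mul_assoc)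
  finally show ?case .
qed simp

lemma mat_pow_eq_0_mono: "mat_pow (A::'a::semiring_1^'n^'n) k = 0 \<Longrightarrow> k \<le> m \<Longrightarrow> mat_pow A m = 0"
  using mat_pow_add[of A k "m - k"] by simp

lemma mat_pow_conj:
  fixes g :: "'a::semiring_1^'n^'n"
  assumes "h ** g = mat 1" "g ** h = mat 1"
  shows "mat_pow (g ** A ** h) k = g ** mat_pow A k ** h"
proof (induction k)
  case (Suc k)
  have "mat_pow (g ** A ** h) (Suc k) = g ** A ** (h ** g) ** mat_pow A k ** h"
    by (simp only: mat_pow.simps Suc matrix_mul_assoc)
  then show ?case using assms by (simp add: matrix_mul_assoc)
qed (use assms in simp)

text \<open>The norm of the type is the Frobenius norm, for which the identity does not have norm 1
  in general; hence the extra factor.\<close>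

lemma norm_mat_pow_le: "norm (mat_pow (A::real^'n^'n) k) \<le> norm (mat 1 :: real^'n^'n) * norm A ^ k"
proof (induction k)
  case (Suc k)
  have "norm (mat_pow A (Suc k)) \<le> norm A * norm (mat_pow A k)"
    by (simp add: norm_matrix_mult_le)
  also have "\<dots> \<le> norm A * (norm (mat 1 :: real^'n^'n) * norm A ^ k)"
    by (intro mult_left_mono Suc) simp
  finally show ?case by (simp add: mult_ac)
qed simp

lemma summable_mat_exp: "summable (\<lambda>k. (1 / fact k) *\<^sub>R mat_pow (A::real^'n^'n) k)"
proof (rule summable_comparison_test)
  show "summable (\<lambda>k. norm (mat 1 :: real^'n^'n) * (inverse (fact k) * norm A ^ k))"
    by (intro summable_mult summable_exp)
  have "norm ((1 / fact k) *\<^sub>R mat_pow A k) \<le> norm (mat 1 :: real^'n^'n) * (inverse (fact k) * norm A ^ k)" for k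
    using mult_left_mono[OF norm_mat_pow_le[of A k], of "1 / fact k"]
    by (simp add: field_simps)
  then show "\<exists>N. \<forall>k\<ge>N. norm ((1 / fact k) *\<^sub>R mat_pow A k) \<le> norm (mat 1 :: real^'n^'n) * (inverse (fact k) * norm A ^ k)"
    by blast
qed

text \<open>Subspaces are closed in finite dimension, so the limit of the partial sums stays in
  \<open>S\<close>. Commutation, symmetry and positivity of degree are linear conditions, and all
  facts about exponentials below are obtained in this way. The zeroth power is split off for
  subspaces that do not contain the identity.\<close>

lemma mat_exp_minus_one_mem:
  fixes X :: "real^'n^'n"
  assumes S: "subspace S" and pow: "\<And>k. mat_pow X (Suc k) \<in> S"
  shows "mat_exp X - mat 1 \<in> S"
proof -
  let ?f = "\<lambda>k. (1 / fact k) *\<^sub>R mat_pow X k"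
  have "(\<lambda>n. \<Sum>k<n. ?f (Suc k)) \<longlonglongrightarrow> (\<Sum>k. ?f (Suc k))"
    using summable_mat_exp[of X] by (intro summable_LIMSEQ) (subst summable_Suc_iff)
  moreover have "(\<Sum>k<n. ?f (Suc k)) \<in> S" for n
    using S pow by (intro subspace_sum subspace_scale)
  ultimately have "(\<Sum>k. ?f (Suc k)) \<in> S"
    using closed_subspace[OF S] by (meson closed_sequentially)
  moreover have "(\<Sum>k. ?f (Suc k)) = mat_exp X - mat 1"
    using suminf_split_head[OF summable_mat_exp[of X]] by (simp add: mat_exp_def)
  ultimately show ?thesis by simp
qed

lemma mat_exp_mem:
  fixes X :: "real^'n^'n"
  assumes S: "subspace S" and pow: "\<And>k. mat_pow X k \<in> S"
  shows "mat_exp X \<in> S"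
proof -
  have "mat_exp X - mat 1 + mat 1 \<in> S"
    using mat_exp_minus_one_mem[OF S pow] pow[of 0] S by (intro subspace_add) auto
  then show ?thesis by simp
qed

lemma mat_exp_0: "mat_exp (0::real^'n^'n) = mat 1"
  using mat_exp_minus_one_mem[of "{0}" "0::real^'n^'n"] by simp

lemma mat_exp_commute:
  fixes X Y :: "real^'n^'n"
  assumes "X ** Y = Y ** X"
  shows "mat_exp X ** Y = Y ** mat_exp X"
proof -
  have "subspace {Z. Z ** Y = Y ** Z}"
    by (auto simp: subspace_def mm.add_left mm.add_right mm.scaleR_left mm.scaleR_right)
  then show ?thesis
    using mat_exp_mem[of "{Z. Z ** Y = Y ** Z}" X] mat_pow_commute[OF assms] by simp
qed

lemma transpose_mat_exp:
  fixes X :: "real^'n^'n"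
  assumes "transpose X = X"
  shows "transpose (mat_exp X) = mat_exp X"
proof -
  have "transpose (mat_pow X k) = mat_pow X k" for k
  proof (induction k)
    case (Suc k)
    have "transpose (mat_pow X (Suc k)) = mat_pow X k ** X"
      using Suc assms by (simp add: matrix_transpose_mul)
    then show ?case by (simp only: mat_pow_Suc_right)
  qed simp
  moreover have "subspace {Z::real^'n^'n. transpose Z = Z}"
    by (auto simp: subspace_def transpose_add transpose_scalar) (simp add: transpose_def vec_eq_iff)
  ultimately show ?thesis
    using mat_exp_mem[of "{Z. transpose Z = Z}" X] by simp
qed

section \<open>Trace and nilpotency\<close>

text \<open>The orthogonal projection onto the column space of \<open>x\<close>. It allows trace
  arguments along the images of powers without choosing bases.\<close>

lemma exists_projection_onto_right_ideal:
  fixes x :: "real^'n^'n"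
  obtains p :: "real^'n^'n" where "transpose p = p" "p ** x = x" "\<exists>y. p = x ** y"
proof -
  let ?R = "range ((**) x :: real^'n^'n \<Rightarrow> real^'n^'n)"
  have sub: "subspace ?R"
    using bounded_linear.linear[OF mm.bounded_linear_right, of x]
    by (rule linear_subspace_image) (rule subspace_UNIV)
  obtain q :: "real^'n^'n \<Rightarrow> real^'n^'n" where q: "\<And>z. q z = 0 \<longleftrightarrow> z \<in> ?R"
    "\<And>z. z - q z \<in> ?R" "\<And>z w. w \<in> ?R \<Longrightarrow> q z \<bullet> w = 0"
    using exists_linear_with_kernel[OF sub] by metis
  \<comment> \<open>The component of the identity in the right ideal is the projection onto it.\<close>
  define p where "p = mat 1 - q (mat 1)"
  have pR: "p \<in> ?R" unfolding p_def by (rule q(2))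
  then obtain y where y: "p = x ** y" by blast
  define r where "r = q (mat 1)"
  have r: "transpose r ** x = 0"
  proof -
    \<comment> \<open>The test element of the ideal is chosen so that the inner product becomes the
      squared norm of \<open>transpose x ** r\<close>.\<close>
    have "r \<bullet> (x ** (transpose x ** r)) = 0" unfolding r_def by (rule q(3)) blast
    moreover have "r \<bullet> (x ** (transpose x ** r)) = (transpose x ** r) \<bullet> (transpose x ** r)"
      by (simp add: inner_matrix_eq_trace matrix_transpose_mul matrix_mul_assoc)
    ultimately have "transpose x ** r = 0" by simp
    then have "transpose (transpose x ** r) = 0" by (simp add: transpose_def vec_eq_iff)
    then show ?thesis by (simp add: matrix_transpose_mul)
  qed
  have pr: "p = mat 1 - r" by (simp add: p_def r_def)
  have "transpose r ** p = 0" by (simp add: y matrix_mul_assoc r)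
  then have "transpose r = transpose r ** r" by (simp add: pr mm.diff_right)
  then have rs: "transpose r = r"
    by (metis matrix_transpose_mul transpose_transpose)
  show ?thesis
  proof (rule that)
    show "transpose p = p" by (simp add: pr transpose_diff rs)
    show "p ** x = x" using r by (simp add: pr mm.diff_left rs)
    show "\<exists>y. p = x ** y" using y by blast
  qed
qed

text \<open>With \<open>p j\<close> the projection onto the image of the j-th power,
  \<open>x\<close> maps that image into the next one, so \<open>trace (x ** p j)\<close> does not
  depend on j. It is \<open>trace x\<close> at j = 0 and vanishes once the power does.\<close>

lemma trace_nilpotent:
  fixes x :: "real^'n^'n"
  assumes "nilpotent_mat x"
  shows "trace x = 0"
proof -
  have "\<forall>j. \<exists>p. p ** mat_pow x j = mat_pow x j \<and> (\<exists>y. p = mat_pow x j ** y)"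
    using exists_projection_onto_right_ideal by metis
  then obtain p where p: "\<And>j. p j ** mat_pow x j = mat_pow x j" "\<And>j. \<exists>y. p j = mat_pow x j ** y"
    by metis
  have step: "trace (x ** p (Suc j)) = trace (x ** p j)" for j
  proof -
    obtain y z where y: "p j = mat_pow x j ** y" and z: "p (Suc j) = mat_pow x (Suc j) ** z"
      using p(2) by metis
    have "x ** p j = mat_pow x (Suc j) ** y" by (simp add: y matrix_mul_assoc)
    then have 1: "p (Suc j) ** (x ** p j) = x ** p j" using p(1) by (simp only: matrix_mul_assoc)
    have "p (Suc j) = mat_pow x j ** (x ** z)"
      unfolding z mat_pow_Suc_right by (simp add: matrix_mul_assoc)
    then have 2: "p j ** p (Suc j) = p (Suc j)" using p(1) by (simp only: matrix_mul_assoc)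
    have "trace (x ** p j) = trace (p j ** (p (Suc j) ** x))"
      using 1 trace_mul_sym[of "p (Suc j) ** x" "p j"] by (simp add: matrix_mul_assoc)
    also have "\<dots> = trace (x ** p (Suc j))"
      using 2 trace_mul_sym[of x "p (Suc j)"] by (simp add: matrix_mul_assoc)
    finally show ?thesis by simp
  qed
  have const: "trace (x ** p j) = trace x" for j
    by (induction j) (use p(1)[of 0] step in simp_all)
  obtain k where "mat_pow x k = 0" using assms nilpotent_mat_def by blast
  then have "p k = 0" using p(2)[of k] by auto
  then show ?thesis using const[of k] by (simp add: linear_0[OF linear_trace])
qed

text \<open>An idempotent has the same trace as the orthogonal projection \<open>p\<close> onto its
  image, because \<open>p ** e = e\<close> and \<open>e ** p = p\<close>; and the trace of
  \<open>p\<close> is its squared norm.\<close>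

lemma idempotent_trace_zero:
  fixes e :: "real^'n^'n"
  assumes "e ** e = e" "trace e = 0"
  shows "e = 0"
proof -
  obtain p y where p: "transpose p = p" "p ** e = e" "p = e ** y"
    using exists_projection_onto_right_ideal[of e] by metis
  have pp: "p ** p = p" using p(2,3) by (metis matrix_mul_assoc)
  have "e ** p = p" using p(3) assms(1) by (metis matrix_mul_assoc)
  then have "trace p = trace e" using trace_mul_sym[of e p] p(2) by simp
  then have "p \<bullet> p = 0" using assms(2) pp p(1) by (simp add: inner_matrix_eq_trace)
  then show ?thesis using p(2) by simp
qed

text \<open>The descending spans \<open>R a\<close> of high powers become stationary. On the stable
  one, multiplication by a power of \<open>x\<close> is onto, which yields the Fitting idempotent
  \<open>e\<close> of \<open>x\<close> as a combination of positive powers. Its trace is zero, so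
  \<open>e = 0\<close>, and with it the power of \<open>x\<close> vanishes.\<close>

lemma nilpotent_if_trace_powers_zero:
  fixes x :: "real^'n^'n"
  assumes tr: "\<And>m. m \<ge> 1 \<Longrightarrow> trace (mat_pow x m) = 0"
  shows "nilpotent_mat x"
proof -
  define R where "R a = span (mat_pow x ` {a..})" for a
  have subR: "subspace (R a)" for a by (simp add: R_def)
  have mono: "R b \<subseteq> R a" if "a \<le> b" for a b
    unfolding R_def using that by (intro span_mono) auto
  \<comment> \<open>Requiring a to be positive excludes the identity from the powers spanning
    \<open>R a\<close>, so that all its elements have trace zero.\<close>
  obtain a where a: "a \<ge> 1" "\<And>b. b \<ge> 1 \<Longrightarrow> dim (R a) \<le> dim (R b)"
    using ex_has_least_nat[of "\<lambda>a. a \<ge> 1" 1 "\<lambda>a. dim (R a)"] by auto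
  have stable: "R b = R a" if "a \<le> b" for b
    by (rule subspace_dim_equal) (use that a subR mono in auto)
  have "(**) (mat_pow x a) ` R a = span ((**) (mat_pow x a) ` mat_pow x ` {a..})"
    unfolding R_def
    using linear_span_image[OF bounded_linear.linear[OF mm.bounded_linear_right]] by metis
  also have "(**) (mat_pow x a) ` mat_pow x ` {a..} = mat_pow x ` {a+a..}"
  proof -
    have "(\<lambda>j. a + j) ` {a..} = {a+a..}"
      by auto
    moreover have "(**) (mat_pow x a) ` mat_pow x ` {a..} = mat_pow x ` (\<lambda>j. a + j) ` {a..}"
      by (simp only: image_image mat_pow_add)
    ultimately show ?thesis by simp
  qed
  finally have img: "(**) (mat_pow x a) ` R a = R a"
    using stable[of "a + a"] unfolding R_def by simp
  have xa: "mat_pow x a \<in> R a" unfolding R_def by (rule span_base) auto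
  then obtain e where e: "e \<in> R a" "mat_pow x a = mat_pow x a ** e" using img by blast
  obtain z where z: "z \<in> R a" "e = mat_pow x a ** z" using img e(1) by blast
  have "mat_pow x a ** z = z ** mat_pow x a"
  proof -
    have "z \<in> span (mat_pow x ` {a..})" using z(1) by (simp add: R_def)
    then show ?thesis
    proof (induction rule: span_induct_alt)
      case (step c u v)
      then obtain j where "u = mat_pow x j" by blast
      then have "mat_pow x a ** u = u ** mat_pow x a" by (simp flip: mat_pow_add add: add.commute)
      then show ?case using step
        by (simp add: mm.add_left mm.add_right mm.scaleR_left mm.scaleR_right)
    qed simp
  qed
  \<comment> \<open>Writing y for the a-th power of \<open>x\<close>: e e = y z e = z y e = z y = y
    z = e.\<close>
  then have "e ** e = e" using z(2) e(2) by (metis matrix_mul_assoc)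
  moreover have "trace e = 0"
  proof -
    have "e \<in> span (mat_pow x ` {a..})" using e(1) by (simp add: R_def)
    then show ?thesis
    proof (induction rule: span_induct_alt)
      case base show ?case using trace_0 by simp
    next
      case (step c u v)
      then show ?case using tr a(1) by (auto simp: linear_add[OF linear_trace] linear_scale[OF linear_trace])
    qed
  qed
  ultimately have "e = 0" by (rule idempotent_trace_zero)
  then show ?thesis using e(2) unfolding nilpotent_mat_def by auto
qed

section \<open>Engel's theorem\<close>

text \<open>The i-th term consists of the matrices annihilated from the left by all products of i
  elements of \<open>W\<close>. That the m-th term is \<open>UNIV\<close> therefore says that all
  m-fold products vanish, as testing on the identity shows. These right ideals play the part of a
  flag of column vectors on which \<open>W\<close> acts strictly triangularly.\<close>

primrec ann_chain :: "(real^'n^'n) set \<Rightarrow> nat \<Rightarrow> (real^'n^'n) set" where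
  "ann_chain W 0 = {0}"
| "ann_chain W (Suc i) = {Y. \<forall>w\<in>W. w ** Y \<in> ann_chain W i}"

lemma subspace_ann_chain: "subspace (ann_chain W i)"
proof (induction i)
  case (Suc i)
  then show ?case by (auto simp: subspace_def mm.add_right mm.scaleR_right)
qed (simp add: subspace_single_0)

lemma ann_chain_Suc_mono: "ann_chain W i \<subseteq> ann_chain W (Suc i)"
  by (induction i) auto

lemma ann_chain_mono: "i \<le> j \<Longrightarrow> ann_chain W i \<subseteq> ann_chain W j"
  by (rule lift_Suc_mono_le[of "ann_chain W"]) (rule ann_chain_Suc_mono)

lemma ann_chain_UNIV_mono: "ann_chain W i = UNIV \<Longrightarrow> i \<le> j \<Longrightarrow> ann_chain W j = UNIV"
  using ann_chain_mono by blast

text \<open>Since \<open>X\<close> normalises \<open>h\<close>, left multiplication by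
  \<open>X\<close> preserves each term of the chain of \<open>h\<close>. Each layer can thus be
  refined by the kernels of powers of \<open>X\<close>: modulo the lower terms an element of the
  span acts as a multiple of \<open>X\<close>. If the k-th power of \<open>X\<close> is zero, a
  layer costs k steps, whence the index \<open>i * k\<close>.\<close>

lemma ann_chain_insert_nilpotent:
  fixes X :: "real^'n^'n"
  assumes m: "ann_chain h m = UNIV" and h: "subspace h"
    and norm: "\<And>w. w \<in> h \<Longrightarrow> w ** X - X ** w \<in> h" and nil: "nilpotent_mat X"
  shows "\<exists>m'. ann_chain (span (insert X h)) m' = UNIV"
proof -
  obtain k where k: "mat_pow X k = 0" using nil nilpotent_mat_def by blast
  let ?E = "ann_chain h" and ?F = "ann_chain (span (insert X h))"
  have inv: "X ** Y \<in> ?E i" if "Y \<in> ?E i" for Y i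
    using that
  proof (induction i arbitrary: Y)
    case (Suc i)
    have "w ** (X ** Y) \<in> ?E i" if "w \<in> h" for w
    proof -
      have "w ** (X ** Y) = X ** (w ** Y) + (w ** X - X ** w) ** Y"
        by (simp add: mm.diff_left matrix_mul_assoc)
      moreover have "X ** (w ** Y) \<in> ?E i" using Suc that by simp
      moreover have "(w ** X - X ** w) ** Y \<in> ?E i" using Suc.prems norm[OF that] by simp
      ultimately show ?thesis using subspace_ann_chain subspace_add by metis
    qed
    then show ?case by simp
  qed simp
  have main: "Y \<in> ?F (i * k + j)" if "Y \<in> ?E (Suc i)" "mat_pow X j ** Y = 0" "?E i \<subseteq> ?F (i * k)" for i j Y
    using that
  proof (induction j arbitrary: Y)
    case 0
    then show ?case using subspace_0[OF subspace_ann_chain] by simp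
  next
    case (Suc j)
    have "w ** Y \<in> ?F (i * k + j)" if w: "w \<in> span (insert X h)" for w
    proof -
      obtain c where c: "w - c *\<^sub>R X \<in> h"
        using w unfolding span_breakdown_eq[of w X h] span_eq_iff[THEN iffD2, OF h] by blast
      have "(w - c *\<^sub>R X) ** Y \<in> ?E i" using Suc.prems(1) c by simp
      then have 1: "(w - c *\<^sub>R X) ** Y \<in> ?F (i * k + j)"
        using Suc.prems(3) ann_chain_mono[of "i*k" "i*k+j"] by auto
      have "mat_pow X j ** (X ** Y) = 0"
        using Suc.prems(2) unfolding mat_pow_Suc_right by (simp add: matrix_mul_assoc)
      then have 2: "X ** Y \<in> ?F (i * k + j)" using Suc.IH inv[OF Suc.prems(1)] Suc.prems(3) by blast
      have "w ** Y = (w - c *\<^sub>R X) ** Y + c *\<^sub>R (X ** Y)"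
        by (simp add: mm.diff_left mm.scaleR_left)
      then show ?thesis using 1 2 subspace_ann_chain by (metis subspace_add subspace_scale)
    qed
    then show ?case by simp
  qed
  have "?E i \<subseteq> ?F (i * k)" for i
  proof (induction i)
    case (Suc i)
    show ?case using main[where j=k] Suc k by (auto simp: add.commute)
  qed simp
  then show ?thesis using m by blast
qed

text \<open>A subalgebra of maximal dimension among those with a terminating chain is all of
  \<open>\<uu>\<close>: otherwise some element outside it normalises it and can be adjoined.\<close>

theorem engel:
  fixes \<uu> :: "(real^'n^'n) set"
  assumes u: "subspace \<uu>" "\<And>X Y. X \<in> \<uu> \<Longrightarrow> Y \<in> \<uu> \<Longrightarrow> X ** Y - Y ** X \<in> \<uu>"
    and nil: "\<And>X. X \<in> \<uu> \<Longrightarrow> nilpotent_mat X"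
  shows "\<exists>m. ann_chain \<uu> m = UNIV"
proof -
  define P where "P h \<longleftrightarrow> subspace h \<and> h \<subseteq> \<uu> \<and> (\<forall>X\<in>h. \<forall>Y\<in>h. X ** Y - Y ** X \<in> h)
    \<and> (\<exists>m. ann_chain h m = UNIV)" for h :: "(real^'n^'n) set"
  have "P {0}" unfolding P_def
    using u(1) by (auto simp: subspace_0 subspace_single_0 intro!: exI[of _ 1])
  moreover have "\<forall>h. P h \<longrightarrow> dim h < Suc (DIM(real^'n^'n))"
    using dim_subset_UNIV le_imp_less_Suc by blast
  ultimately obtain h where Ph: "P h" and max: "\<And>h'. P h' \<Longrightarrow> dim h' \<le> dim h"
    using ex_has_greatest_nat[of P "{0}" dim "Suc (DIM(real^'n^'n))"] by blast
  from Ph have h: "subspace h" "h \<subseteq> \<uu>" "\<And>X Y. X \<in> h \<Longrightarrow> Y \<in> h \<Longrightarrow> X ** Y - Y ** X \<in> h"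
    unfolding P_def by auto
  from Ph obtain m where m: "ann_chain h m = UNIV" unfolding P_def by blast
  show ?thesis
  proof (cases "\<uu> \<subseteq> h")
    case True
    then have "h = \<uu>" using h(2) by (rule equalityI[rotated])
    then show ?thesis using m by (intro exI[of _ m]) simp
  next
    case False
    \<comment> \<open>The adjoint action of h raises the filtration degree r, so an element outside h of
      maximal degree normalises h.\<close>
    define R where "R r = {Y. \<forall>i. \<forall>Z \<in> ann_chain h i. Y ** Z \<in> ann_chain h (i + m - r)}" for r
    have raise: "w ** Y - Y ** w \<in> R (Suc r)" if "w \<in> h" "Y \<in> R r" for w Y r
    proof -
      have "(w ** Y - Y ** w) ** Z \<in> ann_chain h (i + m - Suc r)" if Z: "Z \<in> ann_chain h i" for i Z
      proof -
        have low: "w ** V \<in> ann_chain h (j - 1)" if "V \<in> ann_chain h j" for V j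
          using that \<open>w \<in> h\<close> by (cases j) auto
        have "Y ** Z \<in> ann_chain h (i + m - r)" using that(1) \<open>Y \<in> R r\<close> unfolding R_def by blast
        from low[OF this] have 1: "w ** (Y ** Z) \<in> ann_chain h (i + m - Suc r)" by simp
        have 2: "Y ** (w ** Z) \<in> ann_chain h (i + m - Suc r)"
        proof (cases i)
          case 0
          then show ?thesis using Z subspace_0[OF subspace_ann_chain] by simp
        next
          case (Suc i')
          then have "w ** Z \<in> ann_chain h i'" using low[OF Z] by simp
          then have "Y ** (w ** Z) \<in> ann_chain h (i' + m - r)" using \<open>Y \<in> R r\<close> unfolding R_def by blast
          then show ?thesis using Suc by simp
        qed
        have "(w ** Y - Y ** w) ** Z = w ** (Y ** Z) - Y ** (w ** Z)"
          by (simp add: mm.diff_left matrix_mul_assoc)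
        then show ?thesis using 1 2 subspace_ann_chain subspace_diff by metis
      qed
      then show ?thesis unfolding R_def by blast
    qed
    \<comment> \<open>The offset \<open>m\<close> is chosen so that degree 0 imposes no condition,
      as the index is then at least \<open>m\<close>. In degree 2m the m-th term, which contains the
      identity, is sent to the zeroth, so only the zero matrix remains.\<close>
    have "R 0 = UNIV" unfolding R_def using ann_chain_UNIV_mono[OF m] by auto
    then have r0: "\<not> \<uu> \<inter> R 0 \<subseteq> h" using False by simp
    have "R (m + m) \<subseteq> {0}"
    proof
      fix Y assume "Y \<in> R (m + m)"
      then have "\<And>Z. Z \<in> ann_chain h m \<Longrightarrow> Y ** Z \<in> ann_chain h 0" unfolding R_def by fastforce
      from this[of "mat 1"] show "Y \<in> {0}" using m by simp
    qed
    then have rm: "\<uu> \<inter> R (m + m) \<subseteq> h" using subspace_0[OF h(1)] by blast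
    \<comment> \<open>The last degree in which \<open>\<uu>\<close> still leaves \<open>h\<close>.
      Brackets of \<open>h\<close> with an element of this degree have degree one higher and remain
      in \<open>\<uu>\<close>, hence lie in \<open>h\<close>.\<close>
    obtain r where r: "\<not> \<uu> \<inter> R r \<subseteq> h" "\<uu> \<inter> R (Suc r) \<subseteq> h"
    proof -
      have "\<exists>r. \<not> Q r \<and> Q (Suc r)" if "\<not> Q 0" "Q M" for Q :: "nat \<Rightarrow> bool" and M
        using that(2) by (induction M) (use that(1) in auto)
      from this[of "\<lambda>r. \<uu> \<inter> R r \<subseteq> h", OF r0 rm] show thesis using that by blast
    qed
    then obtain X where X: "X \<in> \<uu>" "X \<in> R r" "X \<notin> h" by blast
    have norm: "w ** X - X ** w \<in> h" if "w \<in> h" for w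
      using raise[OF that X(2)] u(2)[of w X] that h(2) X(1) r(2) by blast
    let ?h = "span (insert X h)"
    have br: "Y ** Z - Z ** Y \<in> ?h" if YZ: "Y \<in> ?h" "Z \<in> ?h" for Y Z
    proof -
      obtain c d where c: "Y - c *\<^sub>R X \<in> h" and d: "Z - d *\<^sub>R X \<in> h"
        using YZ unfolding span_breakdown_eq[of _ X h] span_eq_iff[THEN iffD2, OF h(1)] by blast
      define Y' Z' where "Y' = Y - c *\<^sub>R X" and "Z' = Z - d *\<^sub>R X"
      have YZ_eq: "Y = Y' + c *\<^sub>R X" "Z = Z' + d *\<^sub>R X" by (simp_all add: Y'_def Z'_def)
      have "Y ** Z - Z ** Y = (Y' ** Z' - Z' ** Y') + d *\<^sub>R (Y' ** X - X ** Y') - c *\<^sub>R (Z' ** X - X ** Z')"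
        unfolding YZ_eq by (simp add: mm.add_left mm.add_right mm.scaleR_left mm.scaleR_right algebra_simps)
      moreover have "\<dots> \<in> h"
        using c d unfolding Y'_def[symmetric] Z'_def[symmetric]
        by (intro subspace_diff[OF h(1)] subspace_add[OF h(1)] subspace_scale[OF h(1)] h(3) norm)
      ultimately show ?thesis by (metis insert_iff span_base)
    qed
    have "?h \<subseteq> \<uu>" using span_minimal[of "insert X h" \<uu>] X(1) h(2) u(1) by blast
    moreover have "\<exists>m'. ann_chain ?h m' = UNIV"
      using ann_chain_insert_nilpotent[OF m h(1) norm nil[OF X(1)]] .
    ultimately have "P ?h" unfolding P_def using br by auto
    then have "dim ?h \<le> dim h" by (rule max)
    then have "h = ?h" using h(1) by (intro subspace_dim_equal) (auto intro: span_base)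
    then show ?thesis using X(3) by (metis insertI1 span_base)
  qed
qed

text \<open>Kolchin's theorem: the augmentation ideal of a unipotent group is spanned by matrices of
  trace zero and closed under products, hence consists of nilpotent matrices.\<close>

theorem kolchin:
  fixes V :: "(real^'n^'n) set"
  assumes mult: "\<And>v w. v \<in> V \<Longrightarrow> w \<in> V \<Longrightarrow> v ** w \<in> V"
    and uni: "\<And>v. v \<in> V \<Longrightarrow> unipotent_mat v"
  shows "\<exists>m. ann_chain (span ((\<lambda>v. v - mat 1) ` V)) m = UNIV"
proof -
  let ?N = "span ((\<lambda>v. v - mat 1) ` V)"
  have prod1: "(v - mat 1) ** y \<in> ?N" if "y \<in> ?N" "v \<in> V" for y v
    using that(1)
  proof (induction rule: span_induct_alt)
    case base show ?case by (simp add: span_0)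
  next
    case (step c x y)
    then obtain w where w: "w \<in> V" "x = w - mat 1" by blast
    have "(v - mat 1) ** x = (v ** w - mat 1) - (v - mat 1) - (w - mat 1)"
      by (simp add: w mm.diff_left mm.diff_right)
    moreover have "\<dots> \<in> ?N" by (intro span_diff span_base imageI mult w that)
    ultimately show ?case using step by (simp add: mm.add_right mm.scaleR_right span_add span_scale)
  qed
  have prod: "x ** y \<in> ?N" if "x \<in> ?N" "y \<in> ?N" for x y
    using that(1)
  proof (induction rule: span_induct_alt)
    case base show ?case by (simp add: span_0)
  next
    case (step c x z)
    then show ?case using prod1[OF that(2)] by (auto simp: mm.add_left mm.scaleR_left intro!: span_add span_scale)
  qed
  have tr: "trace x = 0" if "x \<in> ?N" for x
    using that
  proof (induction rule: span_induct_alt)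
    case base show ?case using trace_0 by simp
  next
    case (step c x y)
    then show ?case using trace_nilpotent uni
      by (auto simp: linear_add[OF linear_trace] linear_scale[OF linear_trace] unipotent_mat_def)
  qed
  have pow: "mat_pow x (Suc m) \<in> ?N" if "x \<in> ?N" for x m
    by (induction m) (use that prod in auto)
  show ?thesis
  proof (rule engel)
    show "nilpotent_mat x" if "x \<in> ?N" for x
    proof (rule nilpotent_if_trace_powers_zero)
      fix m :: nat assume "1 \<le> m"
      then show "trace (mat_pow x m) = 0" using tr pow[OF that, of "m - 1"] by simp
    qed
  qed (auto intro: prod span_diff)
qed

section \<open>Orbits of unipotent matrices\<close>

lemma mat_pow_one_plus:
  fixes x :: "real^'n^'n"
  shows "mat_pow (mat 1 + x) j = (\<Sum>m\<le>j. real (j choose m) *\<^sub>R mat_pow x m)"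
proof (induction j)
  case (Suc j)
  have "(\<Sum>m\<le>Suc j. real (Suc j choose m) *\<^sub>R mat_pow x m)
      = mat 1 + (\<Sum>m\<le>j. real (Suc j choose Suc m) *\<^sub>R mat_pow x (Suc m))"
    by (subst sum.atMost_Suc_shift) simp
  also have "(\<Sum>m\<le>j. real (Suc j choose Suc m) *\<^sub>R mat_pow x (Suc m))
     = (\<Sum>m\<le>j. real (j choose m) *\<^sub>R mat_pow x (Suc m)) + (\<Sum>m\<le>j. real (j choose Suc m) *\<^sub>R mat_pow x (Suc m))"
    by (simp add: scaleR_add_left sum.distrib)
  also have "mat 1 + (\<dots>) = (\<Sum>m\<le>j. real (j choose m) *\<^sub>R mat_pow x (Suc m)) + (mat 1 + (\<Sum>m\<le>j. real (j choose Suc m) *\<^sub>R mat_pow x (Suc m)))"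
    by (simp only: add_ac)
  also have "mat 1 + (\<Sum>m\<le>j. real (j choose Suc m) *\<^sub>R mat_pow x (Suc m)) = (\<Sum>m\<le>Suc j. real (j choose m) *\<^sub>R mat_pow x m)"
    by (subst sum.atMost_Suc_shift) simp
  also have "\<dots> = (\<Sum>m\<le>j. real (j choose m) *\<^sub>R mat_pow x m)" by simp
  also have "(\<Sum>m\<le>j. real (j choose m) *\<^sub>R mat_pow x (Suc m)) + \<dots> = (mat 1 + x) ** mat_pow (mat 1 + x) j"
    unfolding Suc by (simp add: mm.add_left mm.sum_right mm.scaleR_right sum.distrib scaleR_add_right)
  finally show ?case by simp
qed simp

text \<open>Consecutive coefficients have ratio (m + 1) / (j - m); the general ratio telescopes into
  such factors.\<close>

lemma binomial_ratio_tendsto_0: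
  assumes "m < r"
  shows "(\<lambda>j. real (j choose m) / real (j choose r)) \<longlonglongrightarrow> 0"
  using assms
proof (induction "r - m" arbitrary: m)
  case (Suc d)
  have step: "(\<lambda>j. real (j choose m) / real (j choose Suc m)) \<longlonglongrightarrow> 0"
  proof (rule Lim_transform_eventually)
    show "(\<lambda>j. real (Suc m) * inverse (real (j - m))) \<longlonglongrightarrow> 0"
    proof (rule tendsto_mult_right_zero)
      show "(\<lambda>j. inverse (real (j - m))) \<longlonglongrightarrow> 0"
        by (rule filterlim_compose[OF lim_inverse_n filterlim_minus_const_nat_at_top])
    qed
    have ratio: "real (Suc m) * inverse (real (j - m)) = real (j choose m) / real (j choose Suc m)" if "j > m" for j
    proof -
      have "Suc m * (j choose Suc m) = (j - m) * (j choose m)"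
        by (metis binomial_absorb_comp binomial_absorption mult.commute)
      then have "real (Suc m) * real (j choose Suc m) = real (j - m) * real (j choose m)"
        by (metis of_nat_mult)
      moreover have "real (j choose Suc m) > 0" "real (j - m) > 0" using that by auto
      ultimately show ?thesis by (simp add: field_simps)
    qed
    from this show "eventually (\<lambda>j. real (Suc m) * inverse (real (j - m)) = real (j choose m) / real (j choose Suc m)) sequentially"
      by (intro eventually_mono[OF eventually_gt_at_top[of m]])
  qed
  show ?case
  proof (cases "Suc m = r")
    case True
    then show ?thesis using step by simp
  next
    case False
    then have "(\<lambda>j. real (j choose Suc m) / real (j choose r)) \<longlonglongrightarrow> 0"
      using Suc by (intro Suc.hyps) auto
    from tendsto_mult[OF step this] have "(\<lambda>j. (real (j choose m) / real (j choose Suc m)) * (real (j choose Suc m) / real (j choose r))) \<longlonglongrightarrow> 0"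
      by simp
    then show ?thesis
    proof (rule Lim_transform_eventually)
      show "eventually (\<lambda>j. (real (j choose m) / real (j choose Suc m)) * (real (j choose Suc m) / real (j choose r)) = real (j choose m) / real (j choose r)) sequentially"
        using eventually_ge_at_top[of "Suc m"] by (rule eventually_mono) (simp add: zero_less_binomial_iff)
    qed
  qed
qed simp

text \<open>By the binomial theorem the orbit of \<open>f\<close> is polynomial in j. Let
  \<open>r\<close> be the last exponent with \<open>mat_pow x r ** f\<close> outside
  \<open>L\<close>. Modulo \<open>L\<close> the term with coefficient \<open>j choose r\<close> then
  dominates, which contradicts boundedness even along a subsequence, since \<open>r\<close> is
  positive if \<open>x ** f\<close> is outside \<open>L\<close>.\<close>

lemma unipotent_orbit_bounded_mod_subspace:
  fixes x f :: "real^'n^'n"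
  assumes L: "subspace L" "\<And>z. z \<in> L \<Longrightarrow> x ** z \<in> L" and nil: "nilpotent_mat x"
    and bdd: "\<exists>\<^sub>\<infinity>j. \<exists>z\<in>L. norm (mat_pow (mat 1 + x) j ** f - z) \<le> C"
  shows "x ** f \<in> L"
proof (rule ccontr)
  assume "x ** f \<notin> L"
  then have ex: "mat_pow x 1 ** f \<notin> L" by simp
  obtain n where n: "mat_pow x n = 0" using nil nilpotent_mat_def by blast
  have bound: "\<forall>r. mat_pow x r ** f \<notin> L \<longrightarrow> r < n"
    using mat_pow_eq_0_mono[OF n] subspace_0[OF L(1)] by (metis not_less times0_left)
  obtain r where r: "mat_pow x r ** f \<notin> L" "\<And>s. mat_pow x s ** f \<notin> L \<Longrightarrow> s \<le> r"
    using ex_has_greatest_nat[of "\<lambda>r. mat_pow x r ** f \<notin> L", OF ex, of "\<lambda>r. r", OF bound] by blast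
  have "r \<ge> 1" using r(2) ex by blast
  obtain q :: "real^'n^'n \<Rightarrow> real^'n^'n" where q: "linear q" "\<And>z. q z = 0 \<longleftrightarrow> z \<in> L" "\<And>z. norm (q z) \<le> norm z"
    using exists_linear_with_kernel[OF L(1)] by metis
  let ?g = "\<lambda>m. q (mat_pow x m ** f)"
  \<comment> \<open>The bound on the leading coefficient after division by
    \<open>j choose r\<close>. The constant \<open>C\<close> is weighted by (j choose 0) / (j choose
    r), which tends to 0 because \<open>r\<close> is at least 1.\<close>
  define b where "b j = C * (1 / real (j choose r)) + (\<Sum>m<r. real (j choose m) / real (j choose r) * norm (?g m))" for j
  have "b \<longlonglongrightarrow> 0"
  proof -
    have "(\<lambda>j. C * (real (j choose 0) / real (j choose r)) + (\<Sum>m<r. real (j choose m) / real (j choose r) * norm (?g m))) \<longlonglongrightarrow> C * 0 + (\<Sum>m<r. 0 * norm (?g m))"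
      using \<open>r \<ge> 1\<close> by (intro tendsto_intros binomial_ratio_tendsto_0) auto
    then show ?thesis by (simp add: b_def[abs_def])
  qed
  moreover have "norm (?g r) > 0" using r(1) q(2) by simp
  ultimately have "eventually (\<lambda>j. b j < norm (?g r)) sequentially"
    by (rule order_tendstoD)
  then have "eventually (\<lambda>j. b j < norm (?g r) \<and> j \<ge> r) sequentially"
    using eventually_ge_at_top by (rule eventually_conj)
  from frequently_ex[OF frequently_eventually_frequently[OF bdd[unfolded cofinite_eq_sequentially] this]]
  obtain j z where j: "b j < norm (?g r)" "j \<ge> r" and z: "z \<in> L" "norm (mat_pow (mat 1 + x) j ** f - z) \<le> C"
    by blast
  have pos: "real (j choose r) > 0" using j(2) by simp
  have "q (mat_pow (mat 1 + x) j ** f - z) = q (mat_pow (mat 1 + x) j ** f)"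
    using z(1) q(2)[of z] by (simp add: linear_diff[OF q(1)])
  also have "\<dots> = (\<Sum>m\<le>j. real (j choose m) *\<^sub>R ?g m)"
    by (simp add: mat_pow_one_plus mm.sum_left mm.scaleR_left linear_sum[OF q(1)] linear_scale[OF q(1)])
  also have "\<dots> = (\<Sum>m\<le>r. real (j choose m) *\<^sub>R ?g m)"
    using j(2) r(2) q(2) by (intro sum.mono_neutral_right) (auto simp: not_le)
  also have "\<dots> = (\<Sum>m<r. real (j choose m) *\<^sub>R ?g m) + real (j choose r) *\<^sub>R ?g r"
    by (simp add: lessThan_Suc_atMost[symmetric])
  finally have eq: "real (j choose r) *\<^sub>R ?g r = q (mat_pow (mat 1 + x) j ** f - z) - (\<Sum>m<r. real (j choose m) *\<^sub>R ?g m)"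
    by simp
  have "real (j choose r) * norm (?g r) = norm (real (j choose r) *\<^sub>R ?g r)" by simp
  also have "\<dots> \<le> C + (\<Sum>m<r. real (j choose m) * norm (?g m))"
    unfolding eq
    by (rule order_trans[OF norm_triangle_ineq4], rule add_mono, rule order_trans[OF q(3) z(2)],
        rule order_trans[OF norm_sum]) simp
  finally have "norm (?g r) \<le> (C + (\<Sum>m<r. real (j choose m) * norm (?g m))) / real (j choose r)"
    using pos by (simp add: field_simps)
  also have "\<dots> = b j"
    by (simp add: b_def add_divide_distrib sum_divide_distrib)
  finally show False using j(1) by simp
qed

section \<open>Fixed points on a compact orbit of subspaces\<close>

text \<open>On the orthogonal complement \<open>C\<close> of \<open>D k\<close> in \<open>P\<close>
  the map y to \<open>q (k ** y)\<close> is injective, hence bounded below by some e. Within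
  distance e/2 of \<open>k\<close> the bound e/2 survives, so \<open>C\<close> still meets
  \<open>D k'\<close> trivially and the dimension cannot jump up. If it does not drop either,
  \<open>C\<close> remains a complement, and \<open>y1\<close> is the component in \<open>C\<close>:
  a uniform bound for the inverse modulo \<open>D k'\<close>.\<close>

lemma dim_preimage_semicontinuous:
  fixes P E :: "(real^'n^'n) set" and k :: "real^'n^'n"
  assumes P: "subspace P" and q: "linear q" "\<And>z. norm (q z) \<le> norm z"
  defines "D \<equiv> \<lambda>k. {y \<in> P. q (k ** y) = (0::real^'n^'n)}"
  shows "\<exists>\<delta>>0. \<forall>k'. norm (k' - k) < \<delta> \<longrightarrow> dim (D k') \<le> dim (D k) \<and>
     (dim (D k') = dim (D k) \<longrightarrow> (\<forall>y\<in>P. \<exists>y1. y - y1 \<in> D k' \<and> \<delta> * norm y1 \<le> norm (q (k' ** y))))"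
proof -
  have lin: "linear (\<lambda>y::real^'n^'n. q (k' ** y))" for k' :: "real^'n^'n"
    using linear_compose[OF bounded_linear.linear[OF mm.bounded_linear_right] q(1)] by (simp add: o_def)
  have subD: "subspace (D k')" for k'
  proof -
    have "D k' = P \<inter> {y. q (k' ** y) = 0}" by (auto simp: D_def)
    then show ?thesis using P linear_subspace_kernel[OF lin] by (simp add: subspace_inter)
  qed
  define C where "C = {y \<in> P. \<forall>w \<in> D k. y \<bullet> w = 0}"
  have subC: "subspace C" unfolding C_def using P
    by (auto simp: subspace_def inner_add_left)
  have CP: "C \<subseteq> P" by (auto simp: C_def)
  have DP: "D k' \<subseteq> P" for k' by (auto simp: D_def)
  have CD: "C \<inter> D k = {0}"
    using subspace_0[OF subC] subspace_0[OF subD] by (auto simp: C_def)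
  have sumP: "dim P \<le> dim {x + y |x y. x \<in> C \<and> y \<in> D k}"
  proof (rule dim_subset, rule subsetI)
    fix y assume y: "y \<in> P"
    obtain q' :: "real^'n^'n \<Rightarrow> real^'n^'n" where q': "\<And>z. z - q' z \<in> D k" "\<And>z w. w \<in> D k \<Longrightarrow> q' z \<bullet> w = 0"
      using exists_linear_with_kernel[OF subD[of k]] by metis
    have "q' y = y - (y - q' y)" by simp
    then have "q' y \<in> P" using y q'(1)[of y] DP P by (metis subsetD subspace_diff)
    then have "q' y \<in> C" using q'(2) by (simp add: C_def)
    moreover have "y = q' y + (y - q' y)" by simp
    ultimately show "y \<in> {x + y |x y. x \<in> C \<and> y \<in> D k}" using q'(1) by blast
  qed
  have dimP: "dim P \<le> dim C + dim (D k)"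
    using sumP dim_sums_Int[OF subC subD[of k]] by (simp add: CD)
  have "\<exists>e>0. \<forall>x\<in>C. norm (q (k ** x)) \<ge> e * norm x"
  proof (rule injective_imp_isometric[OF closed_subspace[OF subC] subC])
    show "bounded_linear (\<lambda>x. q (k ** x))" using lin linear_conv_bounded_linear by blast
    show "\<forall>x\<in>C. q (k ** x) = 0 \<longrightarrow> x = 0" using CD by (auto simp: C_def D_def)
  qed
  then obtain e where e: "e > 0" "\<And>x. x \<in> C \<Longrightarrow> norm (q (k ** x)) \<ge> e * norm x" by blast
  have low: "norm (q (k' ** y)) \<ge> e / 2 * norm y" if "norm (k' - k) < e / 2" "y \<in> C" for k' y
  proof -
    have "norm (q ((k' - k) ** y)) \<le> norm ((k' - k) ** y)" by (rule q(2))
    also have "\<dots> \<le> norm (k' - k) * norm y" by (rule norm_matrix_mult_le)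
    also have "\<dots> \<le> e / 2 * norm y" using that by (intro mult_right_mono) auto
    finally have 1: "norm (q ((k' - k) ** y)) \<le> e / 2 * norm y" .
    have "q (k ** y) = q (k' ** y) - q ((k' - k) ** y)"
      by (simp add: mm.diff_left linear_diff[OF q(1)])
    then have "norm (q (k ** y)) \<le> norm (q (k' ** y)) + norm (q ((k' - k) ** y))"
      using norm_triangle_ineq4 by metis
    then show ?thesis using 1 e(2)[OF that(2)] by simp
  qed
  have CD': "C \<inter> D k' = {0}" if "norm (k' - k) < e / 2" for k'
  proof -
    have "y = 0" if "y \<in> C" "y \<in> D k'" for y
    proof -
      have "e / 2 * norm y \<le> 0" using low[OF \<open>norm (k' - k) < e / 2\<close> that(1)] that(2) by (simp add: D_def)
      then show ?thesis using e(1) by (simp add: mult_le_0_iff)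
    qed
    then show ?thesis using subC subD by (auto simp: subspace_0)
  qed
  let ?S = "\<lambda>k'. {x + y |x y. x \<in> C \<and> y \<in> D k'}"
  have SP: "?S k' \<subseteq> P" for k' using CP DP P by (auto intro!: subspace_add)
  have dimS: "dim (?S k') = dim C + dim (D k')" if "norm (k' - k) < e / 2" for k'
    using dim_sums_Int[OF subC subD[of k']] CD'[OF that] by simp
  show ?thesis
  proof (intro exI[of _ "e / 2"] conjI allI impI ballI)
    show "e / 2 > 0" using e(1) by simp
    fix k' assume k': "norm (k' - k) < e / 2"
    show "dim (D k') \<le> dim (D k)" using dim_subset[OF SP[of k']] dimS[OF k'] dimP by linarith
    assume eq: "dim (D k') = dim (D k)"
    have "?S k' = P"
      by (rule subspace_dim_equal[OF subspace_sums[OF subC subD] P SP]) (use dimS[OF k'] eq dimP in simp)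
    fix y assume "y \<in> P"
    then obtain y1 y2 where y: "y = y1 + y2" "y1 \<in> C" "y2 \<in> D k'" using \<open>?S k' = P\<close> by blast
    have "q (k' ** y) = q (k' ** y1)" using y(1,3) by (simp add: D_def mm.add_right linear_add[OF q(1)])
    then show "\<exists>y1. y - y1 \<in> D k' \<and> e / 2 * norm y1 \<le> norm (q (k' ** y))"
      using low[OF k' y(2)] y by (intro exI[of _ y1]) auto
  qed
qed

text \<open>Among the subspaces k P choose one in the most special position relative to the filtration E.
  The subspaces in this position form a compact set that the group preserves; there the orbit of a
  vector modulo the previous filtration step is bounded, while unipotent orbits are polynomial, so
  it is constant.\<close>

theorem unipotent_fixed_subspace:
  fixes P :: "(real^'n^'n) set" and K V :: "(real^'n^'n) set" and E :: "nat \<Rightarrow> (real^'n^'n) set"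
  assumes P: "subspace P"
    and K: "compact K" "K \<noteq> {}" "\<And>k. k \<in> K \<Longrightarrow> orthogonal_matrix k"
    and E: "\<And>i. subspace (E i)" "E 0 = {0}" "E m = UNIV" "\<And>i. E i \<subseteq> E (Suc i)"
    and V: "mat 1 \<in> V" "\<And>v w. v \<in> V \<Longrightarrow> w \<in> V \<Longrightarrow> v ** w \<in> V"
      "\<And>v. v \<in> V \<Longrightarrow> \<exists>w\<in>V. w ** v = mat 1" "\<And>v. v \<in> V \<Longrightarrow> unipotent_mat v"
    and EV: "\<And>v Y i. v \<in> V \<Longrightarrow> Y \<in> E (Suc i) \<Longrightarrow> (v - mat 1) ** Y \<in> E i"
    and move: "\<And>v k. v \<in> V \<Longrightarrow> k \<in> K \<Longrightarrow> \<exists>k'\<in>K. (**) (v ** k) ` P = (**) k' ` P"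
  shows "\<exists>k\<in>K. \<forall>v\<in>V. \<forall>y\<in>P. v ** (k ** y) \<in> (**) k ` P"
proof -
  have linM: "linear ((**) g :: real^'n^'n \<Rightarrow> real^'n^'n)" for g :: "real^'n^'n"
    by (rule bounded_linear.linear[OF mm.bounded_linear_right])
  have "\<forall>i. \<exists>q :: real^'n^'n \<Rightarrow> real^'n^'n. linear q \<and> (\<forall>z. q z = 0 \<longleftrightarrow> z \<in> E i) \<and> (\<forall>z. norm (q z) \<le> norm z)"
    using exists_linear_with_kernel[OF E(1)] by metis
  then obtain q :: "nat \<Rightarrow> real^'n^'n \<Rightarrow> real^'n^'n" where q: "\<And>i. linear (q i)"
    "\<And>i z. q i z = 0 \<longleftrightarrow> z \<in> E i" "\<And>i z. norm (q i z) \<le> norm z"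
    by metis
  \<comment> \<open>The dimensions of the \<open>D i k\<close> measure the position of k P relative
    to the filtration. Pulling back by \<open>k\<close> keeps all these spaces inside the fixed
    space \<open>P\<close>, where semicontinuity can be applied.\<close>
  define D where "D i k = {y \<in> P. q i (k ** y) = 0}" for i and k :: "real^'n^'n"
  have D_iff: "y \<in> D i k \<longleftrightarrow> y \<in> P \<and> k ** y \<in> E i" for y i k
    by (simp add: D_def q(2))
  have vE: "v ** Y \<in> E i" if "v \<in> V" "Y \<in> E i" for v Y i
  proof (cases i)
    case 0
    then show ?thesis using that E(2) by simp
  next
    case (Suc i')
    have "v ** Y = (v - mat 1) ** Y + Y" by (simp add: mm.diff_left)
    moreover have "(v - mat 1) ** Y \<in> E i" using EV that E(4) Suc by blast
    ultimately show ?thesis using that(2) E(1) by (metis subspace_add)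
  qed
  have invV: "invertible v" if "v \<in> V" for v using V(3)[OF that] matrix_inv_unique' by blast
  have invK: "invertible k" if "k \<in> K" for k
    using K(3)[OF that] by (auto simp: orthogonal_matrix_def invertible_def)
  have inj: "inj_on ((**) g) S" if "invertible g" for g :: "real^'n^'n" and S :: "(real^'n^'n) set"
    using invertible_mult_cancel_left[OF that] by (blast intro: inj_onI)
  have vEinv: "Y \<in> E i" if v: "v \<in> V" and vY: "v ** Y \<in> E i" for v Y i
  proof -
    obtain w where "w \<in> V" "w ** v = mat 1" using V(3)[OF v] by blast
    then show ?thesis using vE[of w "v ** Y" i] vY by (simp add: matrix_mul_assoc)
  qed
  \<comment> \<open>Since \<open>v\<close> preserves each \<open>E i\<close>, it maps the
    intersection of k P with \<open>E i\<close> onto that of k' P.\<close>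
  have dim_inv: "dim (D i k') = dim (D i k)"
    if v: "v \<in> V" and k: "k \<in> K" "k' \<in> K" and eq: "(**) (v ** k) ` P = (**) k' ` P" for v k k' i
  proof -
    have "(**) (v ** k) ` D i k = (**) k' ` D i k'"
    proof (intro equalityI subsetI)
      fix Z assume "Z \<in> (**) (v ** k) ` D i k"
      then obtain y where y: "y \<in> P" "k ** y \<in> E i" "Z = v ** k ** y" by (auto simp: D_iff)
      then obtain y' where y': "y' \<in> P" "Z = k' ** y'" using eq by blast
      have "Z \<in> E i" using vE[OF v y(2)] y(3) by (simp add: matrix_mul_assoc)
      then show "Z \<in> (**) k' ` D i k'" using y' by (auto simp: D_iff)
    next
      fix Z assume "Z \<in> (**) k' ` D i k'"
      then obtain y' where y': "y' \<in> P" "k' ** y' \<in> E i" "Z = k' ** y'" by (auto simp: D_iff)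
      then obtain y where y: "y \<in> P" "Z = v ** k ** y" using eq by blast
      have "v ** (k ** y) \<in> E i" using y y' by (simp add: matrix_mul_assoc)
      then have "k ** y \<in> E i" by (rule vEinv[OF v])
      then show "Z \<in> (**) (v ** k) ` D i k" using y by (auto simp: D_iff)
    qed
    moreover have "dim ((**) (v ** k) ` D i k) = dim (D i k)"
      by (intro dim_image_eq linM inj invertible_mult invV invK v k)
    moreover have "dim ((**) k' ` D i k') = dim (D i k')"
      by (intro dim_image_eq linM inj invK k)
    ultimately show ?thesis by simp
  qed
  \<comment> \<open>Maximising the sum suffices: at a limit of points of \<open>K'\<close>
    semicontinuity gives every dimension at least its value at \<open>k0\<close>, and maximality of
    the sum turns these inequalities into equalities. This makes \<open>K'\<close> closed.\<close>
  define \<sigma> where "\<sigma> k = (\<Sum>i\<le>m. dim (D i k))" for k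
  have "\<sigma> k < Suc (Suc m * DIM(real^'n^'n))" for k
    using sum_bounded_above[of "{..m}" "\<lambda>i. dim (D i k)" "DIM(real^'n^'n)"] dim_subset_UNIV
    by (auto simp: \<sigma>_def simp del: DIM_cart intro: le_imp_less_Suc)
  then obtain k0 where k0: "k0 \<in> K" "\<And>k. k \<in> K \<Longrightarrow> \<sigma> k \<le> \<sigma> k0"
    using ex_has_greatest_nat[of "\<lambda>k. k \<in> K" _ \<sigma> "Suc (Suc m * DIM(real^'n^'n))"] K(2) by blast
  define K' where "K' = {k \<in> K. \<forall>i\<le>m. dim (D i k) = dim (D i k0)}"
  note semi = dim_preimage_semicontinuous[OF P q(1) q(3), folded D_def]
  have closedK': "l \<in> K'" if "\<And>j. s j \<in> K'" and lim: "s \<longlonglongrightarrow> l" and "l \<in> K" for s l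
  proof -
    have ge: "dim (D i k0) \<le> dim (D i l)" if "i \<le> m" for i
    proof -
      obtain \<delta> where \<delta>: "\<delta> > 0" "\<And>k'. norm (k' - l) < \<delta> \<Longrightarrow> dim (D i k') \<le> dim (D i l)"
        using semi[of l i] by blast
      obtain j where "norm (s j - l) < \<delta>"
        using LIMSEQ_D[OF lim \<delta>(1)] by blast
      then show ?thesis using \<delta>(2) \<open>s j \<in> K'\<close> \<open>i \<le> m\<close> unfolding K'_def by force
    qed
    have "dim (D i l) = dim (D i k0)" if "i \<le> m" for i
    proof (rule ccontr)
      assume "dim (D i l) \<noteq> dim (D i k0)"
      then have "dim (D i k0) < dim (D i l)" using ge[OF that] by simp
      then have "\<sigma> k0 < \<sigma> l" unfolding \<sigma>_def
        using ge that by (intro sum_strict_mono_ex1) auto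
      then show False using k0(2)[OF \<open>l \<in> K\<close>] by simp
    qed
    then show ?thesis using \<open>l \<in> K\<close> by (simp add: K'_def)
  qed
  have main: "\<forall>k\<in>K'. \<forall>v\<in>V. \<forall>y\<in>D i k. v ** (k ** y) \<in> (**) k ` P" if "i \<le> m" for i
    using that
  proof (induction i)
    case 0
    show ?case
    proof (intro ballI)
      fix k v y assume "y \<in> D 0 k"
      then have "v ** (k ** y) = k ** 0" using E(2) by (simp add: D_iff)
      then show "v ** (k ** y) \<in> (**) k ` P" using subspace_0[OF P] by blast
    qed
  next
    case (Suc i)
    then have IH: "\<And>k v y. k \<in> K' \<Longrightarrow> v \<in> V \<Longrightarrow> y \<in> D i k \<Longrightarrow> v ** (k ** y) \<in> (**) k ` P" by simp
    show ?case
    proof (intro ballI)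
      fix k v y assume k: "k \<in> K'" and v: "v \<in> V" and y: "y \<in> D (Suc i) k"
      then have kK: "k \<in> K" by (simp add: K'_def)
      define f where "f = k ** y"
      define x where "x = v - mat 1"
      \<comment> \<open>By induction \<open>V\<close> preserves \<open>L\<close>. As
        \<open>v ** f = x ** f + f\<close>, the goal is that \<open>x ** f\<close> lies in
        \<open>L\<close>, which will follow from boundedness of the orbit of \<open>f\<close> modulo
        \<open>L\<close>.\<close>
      define L where "L = (**) k ` P \<inter> E i"
      have vx: "v = mat 1 + x" by (simp add: x_def)
      have subkP: "subspace ((**) k ` P)" by (rule linear_subspace_image[OF linM P])
      have subL: "subspace L" unfolding L_def by (intro subspace_inter subkP E(1))
      have vL: "w ** z \<in> L" if w: "w \<in> V" and z: "z \<in> L" for w z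
      proof -
        obtain y' where y': "y' \<in> P" "z = k ** y'" "z \<in> E i" using z by (auto simp: L_def)
        then have "w ** z \<in> (**) k ` P" using IH[OF k w] by (simp add: D_iff)
        then show ?thesis using vE[OF w y'(3)] by (simp add: L_def)
      qed
      have xL: "x ** z \<in> L" if "z \<in> L" for z
        using vL[OF v that] that subL by (simp add: x_def mm.diff_left subspace_diff)
      have fE: "f \<in> E (Suc i)" and yP: "y \<in> P" using y by (auto simp: f_def D_iff)
      have powV: "mat_pow v j \<in> V" for j by (induction j) (use V(1,2) v in auto)
      \<comment> \<open>All points of the orbit agree modulo \<open>E i\<close>, so
        \<open>q i\<close> is constant on it. This is the source of the bound by
        \<open>norm f\<close>.\<close>
      have powf: "mat_pow v j ** f - f \<in> E i" for j
      proof (induction j)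
        case 0
        show ?case using subspace_0[OF E(1)] by simp
      next
        case (Suc j)
        have "mat_pow v (Suc j) ** f - f = v ** (mat_pow v j ** f - f) + (v - mat 1) ** f"
          by (simp add: mm.diff_left mm.diff_right matrix_mul_assoc)
        then show ?case using vE[OF v Suc] EV[OF v fE] E(1) by (metis subspace_add)
      qed
      have "\<forall>j. \<exists>k'. k' \<in> K' \<and> (**) (mat_pow v j ** k) ` P = (**) k' ` P"
      proof
        fix j
        obtain k' where k': "k' \<in> K" "(**) (mat_pow v j ** k) ` P = (**) k' ` P"
          using move[OF powV kK] by blast
        then have "k' \<in> K'" using dim_inv[OF powV kK k'] k by (simp add: K'_def)
        then show "\<exists>k'. k' \<in> K' \<and> (**) (mat_pow v j ** k) ` P = (**) k' ` P" using k'(2) by blast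
      qed
      then obtain kk where kk: "\<And>j. kk j \<in> K'" "\<And>j. (**) (mat_pow v j ** k) ` P = (**) (kk j) ` P"
        by metis
      have kkK: "kk j \<in> K" for j using kk(1) by (simp add: K'_def)
      \<comment> \<open>Compactness controls only the indices along a subsequence, where one
        constant \<delta>, taken at the limit \<open>l\<close>, applies. For this reason the orbit
        lemma asks for boundedness at infinitely many j only.\<close>
      obtain l r where l: "l \<in> K" "strict_mono r" "(kk \<circ> r) \<longlonglongrightarrow> l"
        using K(1) kkK unfolding compact_def by blast
      have lK': "l \<in> K'" using closedK'[OF _ l(3) l(1)] kk(1) by simp
      obtain \<delta> where \<delta>: "\<delta> > 0" "\<And>k' y. norm (k' - l) < \<delta> \<Longrightarrow> dim (D i k') = dim (D i l) \<Longrightarrow> y \<in> P \<Longrightarrow>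
          \<exists>y1. y - y1 \<in> D i k' \<and> \<delta> * norm y1 \<le> norm (q i (k' ** y))"
        using semi[of l i] by blast
      have near: "\<exists>z\<in>L. norm (mat_pow v j ** f - z) \<le> norm f / \<delta>" if j: "norm (kk j - l) < \<delta>" for j
      proof -
        have "mat_pow v j ** f \<in> (**) (mat_pow v j ** k) ` P"
          using yP by (auto simp: f_def matrix_mul_assoc)
        then obtain yj where yj: "yj \<in> P" "mat_pow v j ** f = kk j ** yj" using kk(2)[of j] by blast
        have "dim (D i (kk j)) = dim (D i l)" using kk(1)[of j] lK' Suc.prems by (simp add: K'_def)
        then obtain y1 where y1: "yj - y1 \<in> D i (kk j)" "\<delta> * norm y1 \<le> norm (q i (kk j ** yj))"
          using \<delta>(2)[OF j _ yj(1)] by blast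
        have "q i (mat_pow v j ** f) = q i (mat_pow v j ** f - f) + q i f"
          by (simp add: linear_diff[OF q(1)])
        then have "norm (q i (kk j ** yj)) \<le> norm f" using powf[of j] q(2)[of i] q(3)[of i f] yj(2)
          by (metis add.left_neutral)
        then have n: "norm y1 \<le> norm f / \<delta>" using y1(2) \<delta>(1) by (simp add: field_simps)
        \<comment> \<open>\<open>z\<close> lies in \<open>E i\<close> and in the translate of k P by
          the j-th power of \<open>v\<close>. Pulling back by that power gives an element of
          \<open>L\<close>, and \<open>L\<close> is stable under \<open>V\<close>.\<close>
        define z where "z = kk j ** (yj - y1)"
        have z1: "z \<in> E i" "yj - y1 \<in> P" using y1(1) by (auto simp: D_iff z_def)
        then have "z \<in> (**) (mat_pow v j ** k) ` P" unfolding kk(2) z_def by blast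
        then obtain y' where y': "y' \<in> P" "z = mat_pow v j ** (k ** y')" by (auto simp: matrix_mul_assoc)
        then have "k ** y' \<in> E i" using vEinv[OF powV[of j]] z1(1) by simp
        then have "k ** y' \<in> L" using y'(1) by (simp add: L_def)
        then have "z \<in> L" using vL[OF powV[of j]] y'(2) by simp
        moreover have "mat_pow v j ** f - z = kk j ** y1" by (simp add: yj(2) z_def mm.diff_right)
        ultimately show ?thesis using n norm_orthogonal_matrix_mult[OF K(3)[OF kkK]] by metis
      qed
      have "\<exists>\<^sub>\<infinity>j. \<exists>z\<in>L. norm (mat_pow (mat 1 + x) j ** f - z) \<le> norm f / \<delta>"
        unfolding INFM_nat_le vx[symmetric]
      proof
        fix n
        obtain N where "\<And>j. j \<ge> N \<Longrightarrow> norm ((kk \<circ> r) j - l) < \<delta>"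
          using LIMSEQ_D[OF l(3) \<delta>(1)] by blast
        then have "norm (kk (r (max n N)) - l) < \<delta>" by simp
        moreover have "r (max n N) \<ge> n" using seq_suble[OF l(2), of "max n N"] by simp
        ultimately show "\<exists>j\<ge>n. \<exists>z\<in>L. norm (mat_pow v j ** f - z) \<le> norm f / \<delta>" using near by blast
      qed
      then have "x ** f \<in> L"
        using unipotent_orbit_bounded_mod_subspace[OF subL xL] V(4)[OF v]
        by (simp add: unipotent_mat_def x_def)
      then have "x ** f \<in> (**) k ` P" by (simp add: L_def)
      moreover have "f \<in> (**) k ` P" using yP by (simp add: f_def)
      moreover have "v ** f = x ** f + f" by (simp add: x_def mm.diff_left)
      ultimately show "v ** (k ** y) \<in> (**) k ` P" using subkP unfolding f_def by (metis subspace_add)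
    qed
  qed
  have "k0 \<in> K'" using k0(1) by (simp add: K'_def)
  moreover have "D m k0 = P" using E(3) by (auto simp: D_iff)
  ultimately have "\<forall>v\<in>V. \<forall>y\<in>P. v ** (k0 ** y) \<in> (**) k0 ` P"
    using bspec[OF main[OF order_refl], of k0] by simp
  then show ?thesis using k0(1) by blast
qed

section \<open>Commuting symmetric matrices\<close>

text \<open>Let M be the maximum of \<open>norm (T x)\<close> on the unit sphere of
  \<open>S\<close>, attained at \<open>x0\<close>. Then T squared has eigenvalue M squared at
  \<open>x0\<close>, so either T x0 = - M x0 or T x0 + M x0 is an eigenvector for M. The invariant
  subspace \<open>S\<close> is kept as a parameter in order to produce joint eigenvectors of
  commuting matrices.\<close>

lemma selfadjoint_nonzero_eigenvector:
  fixes T :: "'a::euclidean_space \<Rightarrow> 'a"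
  assumes T: "linear T" and S: "subspace S" "\<And>x. x \<in> S \<Longrightarrow> T x \<in> S"
    and sa: "\<And>x y. x \<in> S \<Longrightarrow> y \<in> S \<Longrightarrow> T x \<bullet> y = x \<bullet> T y"
    and nz: "z \<in> S" "T z \<noteq> 0"
  shows "\<exists>\<mu> y. \<mu> \<noteq> 0 \<and> y \<in> S \<and> y \<noteq> 0 \<and> T y = \<mu> *\<^sub>R y"
proof -
  have z0: "z \<noteq> 0" using nz(2) linear_0[OF T] by blast
  have "compact (sphere 0 1 \<inter> S)" using closed_subspace[OF S(1)] by (simp add: compact_Int_closed)
  moreover have "z /\<^sub>R norm z \<in> sphere 0 1 \<inter> S" using nz(1) S(1) z0 by (simp add: subspace_scale)
  moreover have "continuous_on (sphere 0 1 \<inter> S) (\<lambda>x. norm (T x))"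
    by (intro continuous_on_norm linear_continuous_on) (use T linear_conv_bounded_linear in blast)
  ultimately obtain x0 where x0: "x0 \<in> sphere 0 1 \<inter> S"
    and mx: "\<And>y. y \<in> sphere 0 1 \<inter> S \<Longrightarrow> norm (T y) \<le> norm (T x0)"
    using continuous_attains_sup[of "sphere 0 1 \<inter> S" "\<lambda>x. norm (T x)"] by blast
  define M where "M = norm (T x0)"
  have bound: "norm (T y) \<le> M * norm y" if "y \<in> S" for y
  proof (cases "y = 0")
    case True
    then show ?thesis using linear_0[OF T] by simp
  next
    case False
    then have "norm (T (y /\<^sub>R norm y)) \<le> M"
      unfolding M_def using that S(1) by (intro mx) (simp add: subspace_scale)
    then show ?thesis using False by (simp add: linear_scale[OF T] field_simps)
  qed
  have x0S: "x0 \<in> S" "norm x0 = 1" using x0 by auto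
  have M: "M > 0" using bound[OF nz(1)] nz(2) z0 by (smt (verit) mult_nonpos_nonneg norm_ge_zero norm_le_zero_iff)
  \<comment> \<open>The equality case of the Cauchy-Schwarz inequality for \<open>T (T x0)\<close>
    and \<open>x0\<close>.\<close>
  have TT: "T (T x0) = M\<^sup>2 *\<^sub>R x0"
  proof -
    have 1: "T (T x0) \<bullet> x0 = M\<^sup>2"
      using sa[OF S(2)[OF x0S(1)] x0S(1)] by (simp add: M_def power2_norm_eq_inner)
    have "norm (T (T x0)) \<le> M\<^sup>2" using bound[OF S(2)[OF x0S(1)]] by (simp add: M_def power2_eq_square)
    then have 2: "T (T x0) \<bullet> T (T x0) \<le> (M\<^sup>2)\<^sup>2"
      unfolding power2_norm_eq_inner[symmetric] by (rule power_mono) simp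
    have 3: "x0 \<bullet> x0 = 1" using x0S(2) by (simp add: norm_eq_1)
    have "(T (T x0) - M\<^sup>2 *\<^sub>R x0) \<bullet> (T (T x0) - M\<^sup>2 *\<^sub>R x0)
       = T (T x0) \<bullet> T (T x0) - 2 * (M\<^sup>2 * (T (T x0) \<bullet> x0)) + M\<^sup>2 * M\<^sup>2 * (x0 \<bullet> x0)"
      by (simp add: inner_diff_left inner_diff_right inner_commute algebra_simps)
    also have "\<dots> \<le> 0" unfolding 1 3 using 2 by (simp add: power2_eq_square)
    finally show ?thesis by (metis inner_eq_zero_iff inner_ge_zero order_antisym eq_iff_diff_eq_0)
  qed
  show ?thesis
  proof (cases "T x0 + M *\<^sub>R x0 = 0")
    case True
    then have "T x0 = (- M) *\<^sub>R x0" by (simp add: eq_neg_iff_add_eq_0)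
    then show ?thesis using M x0S by (intro exI[of _ "- M"] exI[of _ x0]) auto
  next
    case False
    have "T (T x0 + M *\<^sub>R x0) = M *\<^sub>R (T x0 + M *\<^sub>R x0)"
      by (simp add: linear_add[OF T] linear_scale[OF T] TT scaleR_add_right power2_eq_square)
    moreover have "T x0 + M *\<^sub>R x0 \<in> S" using S x0S(1) by (simp add: subspace_add subspace_scale)
    ultimately show ?thesis using M False by (intro exI[of _ M] exI[of _ "T x0 + M *\<^sub>R x0"]) auto
  qed
qed

text \<open>Eigenvectors for distinct eigenvalues are orthogonal, hence independent.\<close>

lemma finite_selfadjoint_eigenvalues:
  fixes T :: "'a::euclidean_space \<Rightarrow> 'a"
  assumes sa: "\<And>x y. T x \<bullet> y = x \<bullet> T y"
  shows "finite {\<mu>. \<exists>y. y \<noteq> 0 \<and> T y = \<mu> *\<^sub>R y}" (is "finite ?E")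
proof -
  define e where "e \<mu> = (SOME y. y \<noteq> 0 \<and> T y = \<mu> *\<^sub>R y)" for \<mu>
  have e: "e \<mu> \<noteq> 0 \<and> T (e \<mu>) = \<mu> *\<^sub>R e \<mu>" if "\<mu> \<in> ?E" for \<mu>
  proof -
    have "\<exists>y. y \<noteq> 0 \<and> T y = \<mu> *\<^sub>R y" using that by simp
    then show ?thesis unfolding e_def by (rule someI_ex)
  qed
  have orth: "e \<mu> \<bullet> e \<nu> = 0" if "\<mu> \<in> ?E" "\<nu> \<in> ?E" "\<mu> \<noteq> \<nu>" for \<mu> \<nu>
  proof -
    have "T (e \<mu>) \<bullet> e \<nu> = \<mu> * (e \<mu> \<bullet> e \<nu>)" "e \<mu> \<bullet> T (e \<nu>) = \<nu> * (e \<mu> \<bullet> e \<nu>)"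
      using e[OF that(1)] e[OF that(2)] by simp_all
    then have "\<mu> * (e \<mu> \<bullet> e \<nu>) = \<nu> * (e \<mu> \<bullet> e \<nu>)" using sa by metis
    then show ?thesis using that(3) by simp
  qed
  have "inj_on e ?E"
  proof (rule inj_onI)
    fix \<mu> \<nu> assume "\<mu> \<in> ?E" "\<nu> \<in> ?E" "e \<mu> = e \<nu>"
    then show "\<mu> = \<nu>" using orth[of \<mu> \<nu>] e[of \<mu>] by (metis inner_eq_zero_iff)
  qed
  moreover have "independent (e ` ?E)"
  proof (rule pairwise_orthogonal_independent)
    show "pairwise orthogonal (e ` ?E)"
      unfolding pairwise_def orthogonal_def using orth by blast
    show "0 \<notin> e ` ?E" using e by force
  qed
  ultimately show ?thesis using independent_imp_finite finite_imageD by blast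
qed

text \<open>The usual real spectrum of \<open>x\<close>, since the columns of \<open>Y\<close> are
  eigenvectors or zero. Taking matrices as eigenvectors keeps the argument in one inner product
  space.\<close>

definition left_eigenvalues :: "real^'n^'n \<Rightarrow> real set" where
  "left_eigenvalues x = {\<mu>. \<exists>Y::real^'n^'n. Y \<noteq> 0 \<and> x ** Y = \<mu> *\<^sub>R Y}"

lemma inner_symmetric_matrix_mult:
  fixes x Y Z :: "real^'n^'n"
  assumes "transpose x = x"
  shows "(x ** Y) \<bullet> Z = Y \<bullet> (x ** Z)"
  by (simp add: inner_matrix_eq_trace matrix_transpose_mul assms matrix_mul_assoc)

text \<open>A nonzero difference d of commuting symmetric matrices has a nonzero eigenvalue
  \<delta>, and \<open>x\<close> has an eigenvector, with eigenvalue \<mu>, in the eigenspace of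
  \<delta>. Then \<mu> and \<mu> + \<delta> both belong to the spectrum of \<open>x\<close>, so the
  norm of d is at least the smallest gap in that spectrum.\<close>

lemma symmetric_commuting_isolated:
  fixes x :: "real^'n^'n"
  assumes x: "transpose x = x"
  shows "\<exists>\<epsilon>>0. \<forall>x'. transpose x' = x' \<longrightarrow> x' ** x = x ** x' \<longrightarrow>
    left_eigenvalues x' \<subseteq> left_eigenvalues x \<longrightarrow> norm (x' - x) < \<epsilon> \<longrightarrow> x' = x"
proof -
  let ?E = "left_eigenvalues x"
  have fin: "finite ?E"
    unfolding left_eigenvalues_def by (rule finite_selfadjoint_eigenvalues) (rule inner_symmetric_matrix_mult[OF x])
  \<comment> \<open>The element 1 keeps the set of gaps nonempty when \<open>x\<close> has only one
    eigenvalue.\<close>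
  let ?G = "insert 1 ((\<lambda>(\<mu>,\<nu>). \<bar>\<mu> - \<nu>\<bar>) ` {(\<mu>,\<nu>) \<in> ?E \<times> ?E. \<mu> \<noteq> \<nu>})"
  define \<epsilon> where "\<epsilon> = Min ?G"
  have finG: "finite ?G" using fin by (simp add: finite_subset[of _ "?E \<times> ?E"] Collect_case_prod_Sigma subset_iff)
  have "\<epsilon> > 0" unfolding \<epsilon>_def using finG by (subst Min_gr_iff) auto
  have gap: "\<epsilon> \<le> \<bar>\<mu> - \<nu>\<bar>" if "\<mu> \<in> ?E" "\<nu> \<in> ?E" "\<mu> \<noteq> \<nu>" for \<mu> \<nu>
    unfolding \<epsilon>_def by (rule Min_le[OF finG]) (use that in force)
  have lin: "linear ((**) g :: real^'n^'n \<Rightarrow> real^'n^'n)" for g :: "real^'n^'n"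
    by (rule bounded_linear.linear[OF mm.bounded_linear_right])
  have "x' = x" if x': "transpose x' = x'" "x' ** x = x ** x'" "left_eigenvalues x' \<subseteq> ?E" "norm (x' - x) < \<epsilon>" for x'
  proof (rule ccontr)
    assume "x' \<noteq> x"
    define d where "d = x' - x"
    have ds: "transpose d = d" by (simp add: d_def transpose_diff x x'(1))
    have dx: "d ** x = x ** d" by (simp add: d_def mm.diff_left mm.diff_right x'(2))
    have dn: "d ** mat 1 \<noteq> 0" using \<open>x' \<noteq> x\<close> by (simp add: d_def)
    have "\<exists>\<delta> (Y0::real^'n^'n). \<delta> \<noteq> 0 \<and> Y0 \<in> UNIV \<and> Y0 \<noteq> 0 \<and> d ** Y0 = \<delta> *\<^sub>R Y0"
      by (rule selfadjoint_nonzero_eigenvector[OF lin subspace_UNIV UNIV_I _ UNIV_I dn])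
        (rule inner_symmetric_matrix_mult[OF ds])
    then obtain \<delta> and Y0 :: "real^'n^'n" where \<delta>: "\<delta> \<noteq> 0" "Y0 \<noteq> 0" "d ** Y0 = \<delta> *\<^sub>R Y0"
      by (elim exE conjE)
    define S where "S = {Y::real^'n^'n. d ** Y = \<delta> *\<^sub>R Y}"
    have S: "subspace S" by (auto simp: S_def subspace_def mm.add_right mm.scaleR_right scaleR_add_right)
    have xS: "x ** Y \<in> S" if "Y \<in> S" for Y
    proof -
      have "d ** (x ** Y) = x ** (d ** Y)" using dx by (simp add: matrix_mul_assoc)
      then show ?thesis using that by (simp add: S_def mm.scaleR_right)
    qed
    have "\<exists>\<mu> Y. Y \<in> S \<and> Y \<noteq> 0 \<and> x ** Y = \<mu> *\<^sub>R Y"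
    proof (cases "x ** Y0 = 0")
      case True
      then show ?thesis using \<delta> by (intro exI[of _ 0] exI[of _ Y0]) (auto simp: S_def)
    next
      case False
      then show ?thesis
        using selfadjoint_nonzero_eigenvector[OF lin S xS, of Y0] inner_symmetric_matrix_mult[OF x] \<delta>(3)
        by (auto simp: S_def)
    qed
    then obtain \<mu> Y where Y: "Y \<in> S" "Y \<noteq> 0" "x ** Y = \<mu> *\<^sub>R Y" by blast
    have dY: "d ** Y = \<delta> *\<^sub>R Y" using Y(1) by (simp add: S_def)
    have "x' ** Y = d ** Y + x ** Y" by (simp add: d_def mm.diff_left)
    then have "x' ** Y = (\<delta> + \<mu>) *\<^sub>R Y" using dY Y(3) by (simp add: scaleR_add_left)
    then have "\<delta> + \<mu> \<in> ?E" using x'(3) Y(2) by (auto simp: left_eigenvalues_def)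
    moreover have "\<mu> \<in> ?E" using Y by (auto simp: left_eigenvalues_def)
    ultimately have "\<epsilon> \<le> \<bar>\<delta>\<bar>" using gap[of "\<delta> + \<mu>" \<mu>] \<delta>(1) by simp
    moreover have "\<bar>\<delta>\<bar> * norm Y \<le> norm d * norm Y"
      using norm_matrix_mult_le[of d Y] dY by simp
    ultimately show False using x'(4) Y(2) by (simp add: d_def)
  qed
  then show ?thesis using \<open>\<epsilon> > 0\<close> by blast
qed

lemma orthogonal_matrix_mat_pow: "orthogonal_matrix (k::real^'n^'n) \<Longrightarrow> orthogonal_matrix (mat_pow k i)"
  by (induction i) (simp_all add: orthogonal_matrix_id orthogonal_matrix_mul)

lemma transpose_mat_pow: "transpose (mat_pow (k::real^'n^'n) i) = mat_pow (transpose k) i"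
proof (induction i)
  case (Suc i)
  then have "transpose (mat_pow k (Suc i)) = mat_pow (transpose k) i ** transpose k"
    by (simp add: matrix_transpose_mul)
  then show ?case by (simp only: mat_pow_Suc_right)
qed simp

text \<open>The conjugates are bounded, so two of them are arbitrarily close. Having the spectrum of
  \<open>x\<close> and commuting with it, a conjugate that is close enough to \<open>x\<close>
  equals \<open>x\<close>.\<close>

lemma orthogonal_conjugates_periodic:
  fixes k x :: "real^'n^'n"
  assumes k: "orthogonal_matrix k" and x: "transpose x = x"
  defines "xs \<equiv> \<lambda>i. mat_pow (transpose k) i ** x ** mat_pow k i"
  assumes comm: "\<And>i. xs i ** x = x ** xs i"
  shows "\<exists>m>0. xs m = x"
proof -
  have ki: "orthogonal_matrix (mat_pow k i)" "orthogonal_matrix (mat_pow (transpose k) i)" for i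
    using k by (simp_all add: orthogonal_matrix_mat_pow)
  have kt: "mat_pow k i ** mat_pow (transpose k) i = mat 1" for i
    using ki(1)[of i] unfolding orthogonal_matrix_def by (simp add: transpose_mat_pow)
  obtain \<epsilon> where \<epsilon>: "\<epsilon> > 0" "\<And>x'. transpose x' = x' \<Longrightarrow> x' ** x = x ** x' \<Longrightarrow>
      left_eigenvalues x' \<subseteq> left_eigenvalues x \<Longrightarrow> norm (x' - x) < \<epsilon> \<Longrightarrow> x' = x"
    using symmetric_commuting_isolated[OF x] by blast
  have norm: "norm (mat_pow (transpose k) i ** Z ** mat_pow k i) = norm Z" for i and Z :: "real^'n^'n"
    by (simp add: norm_orthogonal_matrix_mult_right[OF ki(1)] norm_orthogonal_matrix_mult[OF ki(2)])
  have "\<forall>i. xs i \<in> cball 0 (norm x)" unfolding xs_def using norm by (simp add: dist_norm)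
  moreover have "compact (cball (0::real^'n^'n) (norm x))" by simp
  ultimately obtain l r where lr: "strict_mono r" "(xs \<circ> r) \<longlonglongrightarrow> l"
    unfolding compact_def by blast
  then have "Cauchy (xs \<circ> r)" by (intro LIMSEQ_imp_Cauchy)
  then obtain N where "\<And>i j. i \<ge> N \<Longrightarrow> j \<ge> N \<Longrightarrow> norm ((xs \<circ> r) i - (xs \<circ> r) j) < \<epsilon>"
    using \<epsilon>(1) unfolding Cauchy_iff by blast
  then have close: "norm (xs (r (Suc N)) - xs (r N)) < \<epsilon>" by simp
  \<comment> \<open>Conjugation by k is isometric, so two close terms of the sequence may be shifted back to x.\<close>
  define m where "m = r (Suc N) - r N"
  have "r N < r (Suc N)" using lr(1) by (simp add: strict_mono_def)
  then have m: "m > 0" "r (Suc N) = m + r N" by (simp_all add: m_def)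
  have "xs (m + r N) = mat_pow (transpose k) (r N) ** xs m ** mat_pow k (r N)"
  proof -
    have "mat_pow (transpose k) (m + r N) = mat_pow (transpose k) (r N) ** mat_pow (transpose k) m"
      using mat_pow_add[of "transpose k" "r N" m] by (simp add: add.commute)
    then show ?thesis by (simp add: xs_def mat_pow_add matrix_mul_assoc)
  qed
  then have "xs (r (Suc N)) - xs (r N) = mat_pow (transpose k) (r N) ** (xs m - x) ** mat_pow k (r N)"
    using m(2) by (simp add: xs_def mm.diff_left mm.diff_right)
  then have "norm (xs m - x) < \<epsilon>" using close norm by simp
  moreover have "transpose (xs m) = xs m"
    by (simp add: xs_def matrix_transpose_mul transpose_mat_pow x matrix_mul_assoc)
  moreover have "left_eigenvalues (xs m) \<subseteq> left_eigenvalues x"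
  proof
    fix \<mu> assume "\<mu> \<in> left_eigenvalues (xs m)"
    then obtain Y :: "real^'n^'n" where Y: "Y \<noteq> 0" "xs m ** Y = \<mu> *\<^sub>R Y" by (auto simp: left_eigenvalues_def)
    have "x ** (mat_pow k m ** Y) = mat_pow k m ** (xs m ** Y)"
      by (simp add: xs_def matrix_mul_assoc kt)
    also have "\<dots> = \<mu> *\<^sub>R (mat_pow k m ** Y)" by (simp add: Y(2) mm.scaleR_right)
    finally have "x ** (mat_pow k m ** Y) = \<mu> *\<^sub>R (mat_pow k m ** Y)" .
    moreover have "mat_pow k m ** Y \<noteq> 0"
      using Y(1) norm_orthogonal_matrix_mult[OF ki(1), of m Y] by (metis norm_eq_zero)
    ultimately show "\<mu> \<in> left_eigenvalues x" unfolding left_eigenvalues_def by blast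
  qed
  ultimately have "xs m = x" using \<epsilon>(2) comm by blast
  then show ?thesis using m(1) by blast
qed

section \<open>Unipotent matrices with special polar decomposition\<close>

lemma mat_pow_distrib:
  fixes A B :: "real^'n^'n"
  assumes "A ** B = B ** A"
  shows "mat_pow (A ** B) j = mat_pow A j ** mat_pow B j"
proof (induction j)
  case (Suc j)
  have "mat_pow (A ** B) (Suc j) = A ** (B ** mat_pow A j) ** mat_pow B j"
    using Suc by (simp add: matrix_mul_assoc)
  also have "B ** mat_pow A j = mat_pow A j ** B" using mat_pow_commute[OF assms] by simp
  finally show ?case by (simp add: matrix_mul_assoc)
qed simp

text \<open>The squared norm of the n-th power is the trace of the 2n-th, so the exponent of a
  vanishing power can be lowered down to 1.\<close>

lemma symmetric_nilpotent_eq_0: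
  fixes s :: "real^'n^'n"
  assumes s: "transpose s = s" and "nilpotent_mat s"
  shows "s = 0"
proof -
  have "mat_pow s n = 0 \<Longrightarrow> s = 0" for n
  proof (induction n)
    case 0
    then have "mat 1 = (0::real^'n^'n)" by simp
    then have "s ** mat 1 = s ** 0" by simp
    then show ?case by simp
  next
    case (Suc n)
    show ?case
    proof (cases "n = 0")
      case True
      then show ?thesis using Suc.prems by simp
    next
      case False
      then have "mat_pow s (n + n) = 0" using mat_pow_eq_0_mono[OF Suc.prems] by simp
      then have "mat_pow s n \<bullet> mat_pow s n = 0"
        by (simp add: inner_matrix_eq_trace transpose_mat_pow s mat_pow_add trace_0[unfolded mat_0])
      then show ?thesis using Suc.IH by simp
    qed
  qed
  then show ?thesis using assms(2) nilpotent_mat_def by blast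
qed

lemma normal_nilpotent_eq_0:
  fixes y :: "real^'n^'n"
  assumes y: "transpose y ** y = y ** transpose y" and "nilpotent_mat y"
  shows "y = 0"
proof -
  obtain n where "mat_pow y n = 0" using assms(2) nilpotent_mat_def by blast
  then have "mat_pow (transpose y ** y) n = 0" by (simp add: mat_pow_distrib[OF y])
  then have "transpose y ** y = 0"
    by (intro symmetric_nilpotent_eq_0) (auto simp: matrix_transpose_mul nilpotent_mat_def)
  then have "y \<bullet> y = 0" by (simp add: inner_matrix_eq_trace trace_0[unfolded mat_0])
  then show ?thesis by simp
qed

lemma unipotent_mat_pow:
  fixes u :: "real^'n^'n"
  assumes "unipotent_mat u"
  shows "unipotent_mat (mat_pow u m)"
proof -
  define x where "x = u - mat 1"
  have "\<exists>Z. mat_pow u m - mat 1 = x ** Z \<and> x ** Z = Z ** x"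
  proof (induction m)
    case 0
    show ?case by (intro exI[of _ 0]) simp
  next
    case (Suc m)
    then obtain Z where Z: "mat_pow u m - mat 1 = x ** Z" "x ** Z = Z ** x" by blast
    have p: "mat_pow u m = mat 1 + x ** Z" using Z(1) by (simp add: algebra_simps)
    have u: "u = mat 1 + x" by (simp add: x_def)
    have "mat_pow u (Suc m) - mat 1 = x ** (mat 1 + x ** Z + Z)"
      unfolding mat_pow.simps p unfolding u
      by (simp add: mm.add_left mm.add_right matrix_mul_assoc)
    moreover have "x ** (mat 1 + x ** Z + Z) = (mat 1 + x ** Z + Z) ** x"
    proof -
      have "x ** (x ** Z) = x ** Z ** x" using Z(2) by (simp add: matrix_mul_assoc)
      then show ?thesis using Z(2) by (simp add: mm.add_left mm.add_right)
    qed
    ultimately show ?case by blast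
  qed
  then obtain Z where Z: "mat_pow u m - mat 1 = x ** Z" "x ** Z = Z ** x" by blast
  obtain n where "mat_pow x n = 0" using assms unfolding unipotent_mat_def nilpotent_mat_def x_def by blast
  then have "mat_pow (x ** Z) n = 0" by (simp add: mat_pow_distrib[OF Z(2)])
  then show ?thesis unfolding unipotent_mat_def nilpotent_mat_def Z(1) by blast
qed

text \<open>The orbit of the identity returns to the identity at all multiples of \<open>m\<close>,
  so it is bounded infinitely often, and the orbit lemma applies with the zero subspace.\<close>

lemma unipotent_finite_order:
  fixes u :: "real^'n^'n"
  assumes u: "unipotent_mat u" and m: "m > 0" "mat_pow u m = mat 1"
  shows "u = mat 1"
proof -
  define x where "x = u - mat 1"
  have ux: "mat 1 + x = u" by (simp add: x_def)
  have one: "mat_pow (mat 1 :: real^'n^'n) j = mat 1" for j by (induction j) simp_all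
  have "\<exists>\<^sub>\<infinity>j. \<exists>z\<in>{0}. norm (mat_pow (mat 1 + x) j ** mat 1 - z) \<le> norm (mat 1 :: real^'n^'n)"
    unfolding INFM_nat_le ux
  proof
    fix n
    have "mat_pow u (m * n) = mat 1" by (simp add: mat_pow_mult m(2) one)
    moreover have "m * n \<ge> n" using m(1) by simp
    ultimately show "\<exists>j\<ge>n. \<exists>z\<in>{0}. norm (mat_pow u j ** mat 1 - z) \<le> norm (mat 1 :: real^'n^'n)"
      by (intro exI[of _ "m * n"]) simp
  qed
  from unipotent_orbit_bounded_mod_subspace[OF subspace_single_0 _ _ this]
  have "x ** mat 1 \<in> {0}" using u by (simp add: unipotent_mat_def x_def)
  then show ?thesis by (simp add: x_def)
qed

text \<open>The Gram matrix of the j-th power of u = k a is the product of \<open>xs 0\<close> up to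
  \<open>xs (j - 1)\<close>, which is why squares of \<open>a\<close> occur in \<open>xs\<close>. At
  a period m the power is normal and unipotent, hence the identity, and then u is the identity by
  \<open>unipotent_finite_order\<close>.\<close>

lemma unipotent_polar_trivial:
  fixes k a :: "real^'n^'n"
  assumes k: "orthogonal_matrix k" and a: "transpose a = a" "invertible a"
  defines "xs \<equiv> \<lambda>i. mat_pow (transpose k) i ** (a ** a) ** mat_pow k i"
  assumes comm: "\<And>i. xs i ** a = a ** xs i" and uni: "unipotent_mat (k ** a)"
  shows "k ** a = mat 1"
proof -
  define u where "u = k ** a"
  have kk: "transpose k ** k = mat 1" "k ** transpose k = mat 1" using k by (auto simp: orthogonal_matrix_def)
  have invk: "invertible k" using kk by (auto simp: invertible_def)
  have x0: "xs 0 = a ** a" by (simp add: xs_def)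
  have shift: "transpose k ** xs i ** k = xs (Suc i)" for i
  proof -
    have "xs (Suc i) = (transpose k ** mat_pow (transpose k) i) ** (a ** a) ** (mat_pow k i ** k)"
      unfolding xs_def mat_pow_Suc_right[of k] by simp
    then show ?thesis by (simp add: xs_def matrix_mul_assoc)
  qed
  have "xs i ** (a ** a) = (a ** a) ** xs i" for i
  proof -
    have "xs i ** (a ** a) = (xs i ** a) ** a" by (simp add: matrix_mul_assoc)
    also have "\<dots> = (a ** xs i) ** a" by (simp only: comm)
    also have "\<dots> = a ** (xs i ** a)" by (simp only: matrix_mul_assoc)
    also have "\<dots> = a ** (a ** xs i)" by (simp only: comm)
    also have "\<dots> = (a ** a) ** xs i" by (simp only: matrix_mul_assoc)
    finally show ?thesis .
  qed
  then obtain m where m: "m > 0" "xs m = a ** a"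
    using orthogonal_conjugates_periodic[OF k, of "a ** a"] a(1) unfolding xs_def
    by (auto simp: matrix_transpose_mul)
  \<comment> \<open>The matrix B m, the Gram matrix of the m-th power of k a, commutes with k a since the
    sequence xs has period m; hence that power is normal.\<close>
  define B where "B = rec_nat (mat 1) (\<lambda>i b. b ** xs i)"
  have B: "B 0 = mat 1" "\<And>i. B (Suc i) = B i ** xs i" by (simp_all add: B_def)
  have Ba: "B i ** a = a ** B i" for i
  proof (induction i)
    case (Suc i)
    have "B (Suc i) ** a = B i ** (xs i ** a)" by (simp add: B matrix_mul_assoc)
    also have "\<dots> = (B i ** a) ** xs i" by (simp add: comm matrix_mul_assoc)
    also have "\<dots> = a ** B (Suc i)" by (simp add: Suc B matrix_mul_assoc)
    finally show ?case .
  qed (simp add: B)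
  have x0B: "xs 0 ** B i = B i ** xs 0" for i
  proof -
    have "xs 0 ** B i = a ** (a ** B i)" by (simp add: x0 matrix_mul_assoc)
    also have "\<dots> = a ** B i ** a" by (simp add: Ba[symmetric] matrix_mul_assoc)
    also have "\<dots> = B i ** xs 0" by (simp add: Ba[symmetric] x0 matrix_mul_assoc)
    finally show ?thesis .
  qed
  \<comment> \<open>Conjugation by \<open>k\<close> shifts the product to \<open>xs 1\<close> up to
    \<open>xs i\<close>. At the period, \<open>xs 0 ** Q m\<close> and \<open>xs 0 ** B m\<close>
    agree because \<open>xs m = xs 0\<close>, and cancelling \<open>xs 0\<close> shows that
    \<open>k\<close> commutes with \<open>B m\<close>.\<close>
  define Q where "Q i = transpose k ** B i ** k" for i
  have Q: "Q (Suc i) = Q i ** xs (Suc i)" for i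
  proof -
    have "Q (Suc i) = transpose k ** B i ** (k ** transpose k) ** xs i ** k" by (simp add: Q_def B kk matrix_mul_assoc)
    also have "\<dots> = Q i ** (transpose k ** xs i ** k)" by (simp add: Q_def matrix_mul_assoc)
    finally show ?thesis by (simp add: shift)
  qed
  have Q0: "Q 0 = mat 1" by (simp add: Q_def B kk)
  have x0Q: "xs 0 ** Q i = B (Suc i)" for i
  proof (induction i)
    case (Suc i)
    have "xs 0 ** Q (Suc i) = (xs 0 ** Q i) ** xs (Suc i)" by (simp add: Q matrix_mul_assoc)
    then show ?case by (simp add: Suc B)
  qed (simp add: Q0 B)
  have Qa: "Q i ** a = a ** Q i" for i
  proof (induction i)
    case (Suc i)
    have "Q (Suc i) ** a = Q i ** (xs (Suc i) ** a)" by (simp add: Q matrix_mul_assoc)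
    also have "\<dots> = (Q i ** a) ** xs (Suc i)" by (simp add: comm matrix_mul_assoc)
    also have "\<dots> = a ** Q (Suc i)" by (simp add: Suc Q matrix_mul_assoc)
    finally show ?case .
  qed (simp add: Q0)
  have uu: "transpose (mat_pow u j) ** mat_pow u j = B j" for j
  proof (induction j)
    case (Suc j)
    have "transpose (mat_pow u (Suc j)) ** mat_pow u (Suc j)
        = transpose u ** (transpose (mat_pow u j) ** mat_pow u j) ** u"
      unfolding mat_pow_Suc_right by (simp add: matrix_transpose_mul matrix_mul_assoc)
    also have "\<dots> = a ** Q j ** a" unfolding Suc by (simp add: u_def matrix_transpose_mul a(1) Q_def matrix_mul_assoc)
    also have "\<dots> = a ** (a ** Q j)" by (simp add: Qa[symmetric] matrix_mul_assoc)
    also have "\<dots> = B (Suc j)" using x0Q[of j] by (simp add: x0 matrix_mul_assoc)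
    finally show ?case .
  qed (simp add: B)
  have "xs 0 ** Q m = xs 0 ** B m" using x0Q[of m] B(2)[of m] m(2) x0 x0B[of m] by simp
  then have "Q m = B m" using invertible_mult_cancel_left[of "xs 0"] a(2) by (simp add: x0 invertible_mult)
  then have "k ** (transpose k ** B m ** k) = k ** B m" by (simp add: Q_def)
  then have kB: "B m ** k = k ** B m" by (simp add: matrix_mul_assoc kk)
  have "u ** B m = k ** (B m ** a)" by (simp add: u_def Ba matrix_mul_assoc)
  also have "\<dots> = B m ** u" by (simp add: u_def kB matrix_mul_assoc)
  finally have uB: "u ** B m = B m ** u" .
  define w where "w = mat_pow u m"
  have ww: "transpose w ** w = B m" using uu[of m] by (simp add: w_def)
  have wB: "w ** B m = B m ** w" unfolding w_def by (rule mat_pow_commute[OF uB])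
  have "invertible u" using invk a(2) by (simp add: u_def invertible_mult)
  then have invw: "invertible w" unfolding w_def
    by (induction m) (auto simp: invertible_mult, auto simp: invertible_def)
  have "(w ** transpose w) ** w = B m ** w" using ww wB by (simp add: matrix_mul_assoc[symmetric])
  then have "w ** transpose w = B m" by (rule invertible_mult_cancel_right[OF invw])
  then have "w - mat 1 = 0"
    using unipotent_mat_pow[OF uni[folded u_def], of m] ww
    by (intro normal_nilpotent_eq_0) (simp_all add: w_def unipotent_mat_def transpose_diff mm.diff_left mm.diff_right)
  then have "mat_pow u m = mat 1" by (simp add: w_def)
  then show ?thesis using unipotent_finite_order[OF uni[folded u_def] m(1)] by (simp add: u_def)
qed

section \<open>The grading of matrices by a symmetric matrix\<close>

definition ad_space :: "real^'n^'n \<Rightarrow> real \<Rightarrow> (real^'n^'n) set" where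
  "ad_space H c = {Y. H ** Y - Y ** H = c *\<^sub>R Y}"

text \<open>The set \<open>{0}\<close> gives the centraliser of \<open>H\<close>,
  \<open>{0..}\<close> the parabolic algebra called P in the overview, and \<open>{0<..}\<close> its
  nilpotent ideal; their multiplication rules are all instances of
  \<open>ad_sum_mult\<close>.\<close>

definition ad_sum :: "real^'n^'n \<Rightarrow> real set \<Rightarrow> (real^'n^'n) set" where
  "ad_sum H C = span (\<Union>c\<in>C. ad_space H c)"

lemma subspace_ad_sum [simp]: "subspace (ad_sum H C)"
  by (simp add: ad_sum_def)

lemma ad_space_subset_ad_sum: "c \<in> C \<Longrightarrow> Y \<in> ad_space H c \<Longrightarrow> Y \<in> ad_sum H C"
  unfolding ad_sum_def by (blast intro: span_base)

lemma ad_sum_mono: "C \<subseteq> D \<Longrightarrow> ad_sum H C \<subseteq> ad_sum H D"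
  unfolding ad_sum_def by (intro span_mono) blast

lemma ad_sum_induct [consumes 1, case_names zero step]:
  assumes "Y \<in> ad_sum H C" and "Q 0"
    and "\<And>r c X Z. c \<in> C \<Longrightarrow> X \<in> ad_space H c \<Longrightarrow> Q Z \<Longrightarrow> Q (r *\<^sub>R X + Z)"
  shows "Q Y"
  using assms(1) unfolding ad_sum_def
  by (induction rule: span_induct_alt) (use assms(2,3) in auto)

text \<open>The bracket with \<open>H\<close> is a derivation of the matrix product.\<close>

lemma ad_space_mult:
  assumes "Y \<in> ad_space H c" "Z \<in> ad_space H d"
  shows "Y ** Z \<in> ad_space H (c + d)"
proof -
  have "H ** (Y ** Z) - (Y ** Z) ** H = (H ** Y - Y ** H) ** Z + Y ** (H ** Z - Z ** H)"
    by (simp add: mm.diff_left mm.diff_right matrix_mul_assoc)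
  also have "\<dots> = (c + d) *\<^sub>R (Y ** Z)"
    using assms by (simp add: ad_space_def mm.scaleR_left mm.scaleR_right scaleR_add_left)
  finally show ?thesis by (simp add: ad_space_def)
qed

lemma ad_sum_mult:
  assumes "Y \<in> ad_sum H C" "Z \<in> ad_sum H D" and F: "\<And>c d. c \<in> C \<Longrightarrow> d \<in> D \<Longrightarrow> c + d \<in> F"
  shows "Y ** Z \<in> ad_sum H F"
  using assms(1)
proof (induction rule: ad_sum_induct)
  case zero
  show ?case by (simp add: subspace_0)
next
  case (step r c X Y)
  have "X ** Z \<in> ad_sum H F"
    using assms(2)
  proof (induction rule: ad_sum_induct)
    case zero
    show ?case by (simp add: subspace_0)
  next
    case (step s d W Z)
    have "X ** W \<in> ad_sum H F"
      using ad_space_mult[OF \<open>X \<in> ad_space H c\<close> step(2)] F[OF \<open>c \<in> C\<close> step(1)]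
      by (rule ad_space_subset_ad_sum[rotated])
    then show ?case using step(3)
      by (simp add: mm.add_right mm.scaleR_right subspace_add subspace_scale)
  qed
  then show ?case using step(3)
    by (simp add: mm.add_left mm.scaleR_left subspace_add subspace_scale)
qed

lemmas ad_sum_mult_0 = ad_sum_mult[where C="{0}" and D="{0}" and F="{0}", simplified]
  and ad_sum_mult_nonneg = ad_sum_mult[where C="{0..}" and D="{0..}" and F="{0..}", simplified]
  and ad_sum_mult_pos = ad_sum_mult[where C="{0..}" and D="{0<..}" and F="{0<..}", simplified]
  and ad_sum_mult_pos' = ad_sum_mult[where C="{0<..}" and D="{0..}" and F="{0<..}", simplified]

lemma ad_sum_0_iff: "Y \<in> ad_sum H {0} \<longleftrightarrow> H ** Y = Y ** H"
proof
  assume "Y \<in> ad_sum H {0}"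
  then show "H ** Y = Y ** H"
    by (induction rule: ad_sum_induct)
      (simp_all add: ad_space_def mm.add_left mm.add_right mm.scaleR_left mm.scaleR_right)
qed (rule ad_space_subset_ad_sum[of 0], auto simp: ad_space_def)

lemma ad_sum_0_subset_nonneg: "ad_sum H {0} \<subseteq> ad_sum H {0..}"
  by (rule ad_sum_mono) simp

lemma ad_sum_pos_subset_nonneg: "ad_sum H {0<..} \<subseteq> ad_sum H {0..}"
  by (rule ad_sum_mono) auto

lemma ad_sum_nonneg_decomp:
  assumes "Y \<in> ad_sum H {0..}"
  obtains Y0 Z where "Y0 \<in> ad_sum H {0}" "Z \<in> ad_sum H {0<..}" "Y = Y0 + Z"
proof -
  have "\<exists>Y0 Z. Y0 \<in> ad_sum H {0} \<and> Z \<in> ad_sum H {0<..} \<and> Y = Y0 + Z"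
    using assms
  proof (induction rule: ad_sum_induct)
    case zero
    show ?case by (intro exI[of _ 0]) (simp add: subspace_0)
  next
    case (step r c X Y)
    then obtain Y0 Z where Y: "Y0 \<in> ad_sum H {0}" "Z \<in> ad_sum H {0<..}" "Y = Y0 + Z" by blast
    show ?case
    proof (cases "c = 0")
      case True
      then have "r *\<^sub>R X + Y0 \<in> ad_sum H {0}"
        using step(2) Y(1) ad_space_subset_ad_sum[of 0 "{0}" X H] by (simp add: subspace_add subspace_scale)
      then show ?thesis using Y by (intro exI[of _ "r *\<^sub>R X + Y0"] exI[of _ Z]) simp
    next
      case False
      then have "r *\<^sub>R X + Z \<in> ad_sum H {0<..}"
        using step(1,2) Y(2) ad_space_subset_ad_sum[of c "{0<..}" X H] by (simp add: subspace_add subspace_scale)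
      then show ?thesis using Y by (intro exI[of _ Y0] exI[of _ "r *\<^sub>R X + Z"]) simp
    qed
  qed
  then show ?thesis using that by blast
qed

lemma ad_sum_pos_pow: "Z \<in> ad_sum H {0<..} \<Longrightarrow> mat_pow Z (Suc k) \<in> ad_sum H {0<..}"
proof (induction k)
  case (Suc k)
  then have "Z ** mat_pow Z (Suc k) \<in> ad_sum H {0<..}"
    using ad_sum_mult_pos' ad_sum_pos_subset_nonneg by blast
  then show ?case by simp
qed simp

lemma ad_sum_inverse_nonneg:
  assumes "g \<in> ad_sum H {0..}" "invertible g" "h ** g = mat 1"
  shows "h \<in> ad_sum H {0..}"
proof -
  have 1: "mat 1 \<in> ad_sum H {0..}"
    using ad_sum_0_subset_nonneg ad_sum_0_iff[of "mat 1" H] by auto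
  have "h ** mat 1 \<in> ad_sum H {0..}"
    by (rule inverse_preserves_subspace[OF subspace_ad_sum assms(2) _ assms(3) 1])
      (rule ad_sum_mult_nonneg[OF assms(1)])
  then show ?thesis by simp
qed

context
  fixes H :: "real^'n^'n"
  assumes H: "transpose H = H"
begin

text \<open>For symmetric \<open>H\<close> the bracket with \<open>H\<close> is self-adjoint for the
  trace inner product, so eigenspaces for distinct eigenvalues are orthogonal. This makes the
  decomposition by degree unique.\<close>

lemma ad_sum_orthogonal:
  assumes "Y \<in> ad_sum H C" "Z \<in> ad_sum H D" "C \<inter> D = {}"
  shows "Y \<bullet> Z = 0"
proof -
  have ad: "(H ** Y - Y ** H) \<bullet> Z = Y \<bullet> (H ** Z - Z ** H)" for Y Z :: "real^'n^'n"
  proof -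
    have "(Y ** H) \<bullet> Z = trace (H ** (transpose Y ** Z))"
      by (simp add: inner_matrix_eq_trace matrix_transpose_mul H matrix_mul_assoc)
    also have "\<dots> = trace ((transpose Y ** Z) ** H)" by (rule trace_mul_sym)
    also have "\<dots> = Y \<bullet> (Z ** H)" by (simp add: inner_matrix_eq_trace matrix_mul_assoc)
    finally have "(Y ** H) \<bullet> Z = Y \<bullet> (Z ** H)" .
    then show ?thesis by (simp add: inner_diff_left inner_diff_right inner_symmetric_matrix_mult[OF H])
  qed
  have pair: "X \<bullet> W = 0" if "X \<in> ad_space H c" "W \<in> ad_space H d" "c \<noteq> d" for X W c d
  proof -
    have "c * (X \<bullet> W) = d * (X \<bullet> W)" using ad[of X W] that by (simp add: ad_space_def)
    then show ?thesis using that(3) by simp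
  qed
  show ?thesis using assms(1)
  proof (induction rule: ad_sum_induct)
    case (step r c X Y)
    have "X \<bullet> Z = 0" using assms(2)
    proof (induction rule: ad_sum_induct)
      case (step s d W Z)
      moreover have "c \<noteq> d" using \<open>c \<in> C\<close> step(1) assms(3) by blast
      ultimately show ?case using pair[OF \<open>X \<in> ad_space H c\<close>] by (simp add: inner_add_right)
    qed simp
    then show ?case using step(3) by (simp add: inner_add_left)
  qed simp
qed

lemma ad_sum_Int_eq_0: "Y \<in> ad_sum H C \<Longrightarrow> Y \<in> ad_sum H D \<Longrightarrow> C \<inter> D = {} \<Longrightarrow> Y = 0"
  using ad_sum_orthogonal[of Y C Y D] by simp

lemma transpose_ad_sum:
  assumes "Y \<in> ad_sum H C"
  shows "transpose Y \<in> ad_sum H (uminus ` C)"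
  using assms
proof (induction rule: ad_sum_induct)
  case zero
  show ?case by (simp add: linear_0[OF linear_transpose] subspace_0)
next
  case (step r c X Z)
  have "transpose (H ** X - X ** H) = c *\<^sub>R transpose X"
    using step(2) by (simp add: ad_space_def transpose_scalar)
  then have "H ** transpose X - transpose X ** H = (- c) *\<^sub>R transpose X"
    by (simp add: transpose_diff matrix_transpose_mul H algebra_simps)
  then have "transpose X \<in> ad_sum H (uminus ` C)"
    using step(1) by (intro ad_space_subset_ad_sum[of "- c"]) (auto simp: ad_space_def)
  then show ?case using step(3) by (simp add: transpose_add transpose_scalar subspace_add subspace_scale)
qed

text \<open>All positive powers have positive degree and are orthogonal to the identity, which has
  degree 0; being orthogonal to the identity means having trace zero.\<close>

lemma ad_sum_pos_nilpotent:
  assumes "Z \<in> ad_sum H {0<..}"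
  shows "nilpotent_mat Z"
proof (rule nilpotent_if_trace_powers_zero)
  fix m :: nat assume "1 \<le> m"
  then have "mat_pow Z m \<in> ad_sum H {0<..}" using ad_sum_pos_pow[OF assms, of "m - 1"] by simp
  moreover have "mat 1 \<in> ad_sum H {0}" by (simp add: ad_sum_0_iff)
  ultimately have "mat 1 \<bullet> mat_pow Z m = 0" by (intro ad_sum_orthogonal) auto
  then show "trace (mat_pow Z m) = 0" by (simp add: inner_matrix_eq_trace)
qed

text \<open>The inverse of \<open>k\<close> lies in the same algebra. As it equals the transpose,
  the transposed positive part of \<open>k\<close> has both nonnegative and negative degree, so it
  vanishes.\<close>

lemma orthogonal_ad_sum_nonneg:
  assumes k: "orthogonal_matrix k" "k \<in> ad_sum H {0..}"
  shows "k \<in> ad_sum H {0}"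
proof -
  have "invertible k" "transpose k ** k = mat 1"
    using k(1) unfolding orthogonal_matrix_def invertible_def by auto
  then have kt: "transpose k \<in> ad_sum H {0..}" using ad_sum_inverse_nonneg[OF k(2)] by blast
  obtain k0 Z where k0: "k0 \<in> ad_sum H {0}" "Z \<in> ad_sum H {0<..}" "k = k0 + Z"
    using ad_sum_nonneg_decomp[OF k(2)] .
  have "transpose k0 \<in> ad_sum H {0..}"
    using transpose_ad_sum[OF k0(1)] ad_sum_0_subset_nonneg by auto
  moreover have "transpose Z = transpose k - transpose k0" by (simp add: k0(3) transpose_add)
  ultimately have "transpose Z \<in> ad_sum H {0..}" using kt by (simp add: subspace_diff)
  moreover have "transpose Z \<in> ad_sum H (uminus ` {0<..})" by (rule transpose_ad_sum[OF k0(2)])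
  ultimately have "transpose Z = 0" by (rule ad_sum_Int_eq_0) auto
  then have "transpose (transpose Z) = 0" by (simp only: linear_0[OF linear_transpose])
  then show ?thesis using k0 by simp
qed

text \<open>Taking the part of degree 0 is multiplicative on matrices of nonnegative degree.\<close>

lemma nilpotent_ad_sum_0_part:
  assumes Y: "Y \<in> ad_sum H {0}" and Z: "Z \<in> ad_sum H {0<..}" and nil: "nilpotent_mat (Y + Z)"
  shows "nilpotent_mat Y"
proof -
  have Y': "Y \<in> ad_sum H {0..}" using Y ad_sum_0_subset_nonneg by blast
  have YZ: "Y + Z \<in> ad_sum H {0..}"
    by (intro subspace_add[OF subspace_ad_sum] Y' subsetD[OF ad_sum_pos_subset_nonneg Z])
  have pow0: "mat_pow Y n \<in> ad_sum H {0}" for n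
    by (induction n) (simp_all add: ad_sum_0_iff[of "mat 1"] ad_sum_mult_0 Y)
  have "mat_pow (Y + Z) n - mat_pow Y n \<in> ad_sum H {0<..}" for n
  proof (induction n)
    case 0
    show ?case by (simp add: subspace_0)
  next
    case (Suc n)
    have "mat_pow (Y + Z) (Suc n) - mat_pow Y (Suc n)
        = (Y + Z) ** (mat_pow (Y + Z) n - mat_pow Y n) + Z ** mat_pow Y n"
      by (simp add: mm.diff_right mm.add_left)
    moreover have "(Y + Z) ** (mat_pow (Y + Z) n - mat_pow Y n) \<in> ad_sum H {0<..}"
      by (rule ad_sum_mult_pos[OF YZ Suc])
    moreover have "Z ** mat_pow Y n \<in> ad_sum H {0<..}"
      using ad_sum_mult_pos'[OF Z] pow0 ad_sum_0_subset_nonneg by blast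
    ultimately show ?case by (simp add: subspace_add)
  qed
  moreover obtain n where "mat_pow (Y + Z) n = 0" using nil nilpotent_mat_def by blast
  ultimately have "- mat_pow Y n \<in> ad_sum H {0<..}" by (metis diff_0)
  then have "mat_pow Y n \<in> ad_sum H {0<..}" using subspace_neg[OF subspace_ad_sum] by fastforce
  then have "mat_pow Y n = 0" using pow0 by (intro ad_sum_Int_eq_0[of _ "{0}"]) auto
  then show ?thesis by (auto simp: nilpotent_mat_def)
qed

end

section \<open>Unipotent subgroups and the Iwasawa decomposition\<close>

text \<open>The decomposition reduced to facts about groups, so that roots and Lie algebras need not
  be mentioned again. \<open>N_pos\<close> is only an inclusion; \<open>N_iff\<close> turns it into
  a description of \<open>N\<close>.\<close>

locale iwasawa_kan =
  fixes G K A N :: "(real^'n^'n) set" and H :: "real^'n^'n"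
  assumes H_sym: "transpose H = H"
    and G_one: "mat 1 \<in> G" and G_mult: "g \<in> G \<Longrightarrow> h \<in> G \<Longrightarrow> g ** h \<in> G"
    and G_inv: "g \<in> G \<Longrightarrow> matrix_inv g \<in> G" and G_invertible: "g \<in> G \<Longrightarrow> invertible g"
    and G_closed: "closedin (top_of_set {g. invertible g}) G"
    and K_eq: "K = G \<inter> {k. orthogonal_matrix k}"
    and A_one: "mat 1 \<in> A" and A_sym: "a \<in> A \<Longrightarrow> transpose a = a"
    and A_H: "a \<in> A \<Longrightarrow> H ** a = a ** H" and A_comm: "a \<in> A \<Longrightarrow> b \<in> A \<Longrightarrow> a ** b = b ** a"
    and N_one: "mat 1 \<in> N" and N_pos: "u \<in> N \<Longrightarrow> u - mat 1 \<in> ad_sum H {0<..}"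
    and KAN: "G = {k ** x ** u | k x u. k \<in> K \<and> x \<in> A \<and> u \<in> N}"
begin

lemma K_one: "mat 1 \<in> K"
  by (simp add: K_eq G_one orthogonal_matrix_id)

lemma A_subset_G: "a \<in> A \<Longrightarrow> a \<in> G"
  using KAN K_one N_one matrix_mul_lid matrix_mul_rid by fastforce

lemma N_subset_G: "u \<in> N \<Longrightarrow> u \<in> G"
  using KAN K_one A_one matrix_mul_lid by fastforce

lemma one_nonneg: "mat 1 \<in> ad_sum H {0..}"
  using ad_sum_0_subset_nonneg ad_sum_0_iff[of "mat 1" H] by auto

lemma A_0: "a \<in> A \<Longrightarrow> a \<in> ad_sum H {0}"
  by (simp add: ad_sum_0_iff A_H)

lemma AN_nonneg:
  assumes "a \<in> A" "u \<in> N"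
  shows "a ** u \<in> ad_sum H {0..}"
proof -
  have "u = (u - mat 1) + mat 1" by simp
  then have "u \<in> ad_sum H {0..}"
    using N_pos[OF assms(2)] ad_sum_pos_subset_nonneg one_nonneg subspace_ad_sum
    by (metis subsetD subspace_add)
  then show ?thesis using A_0[OF assms(1)] ad_sum_0_subset_nonneg ad_sum_mult_nonneg by blast
qed

text \<open>The product a u is a unit of the algebra of nonnegative degrees, so \<open>k\<close>
  lies in that algebra too, and an orthogonal matrix there has degree 0.\<close>

lemma nonneg_decomp:
  assumes g: "g \<in> G" "g \<in> ad_sum H {0..}"
  obtains k a u where "k \<in> K" "a \<in> A" "u \<in> N" "g = k ** a ** u" "k \<in> ad_sum H {0}"
    "k ** a \<in> ad_sum H {0}" "k ** a ** (u - mat 1) \<in> ad_sum H {0<..}"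
proof -
  obtain k a u where d: "k \<in> K" "a \<in> A" "u \<in> N" "g = k ** a ** u" using g(1) KAN by blast
  have inv: "invertible (a ** u)" using d A_subset_G N_subset_G G_mult G_invertible by blast
  have "matrix_inv (a ** u) \<in> ad_sum H {0..}"
    by (rule ad_sum_inverse_nonneg[OF AN_nonneg[OF d(2,3)] inv matrix_inv_mult(2)[OF inv]])
  then have "g ** matrix_inv (a ** u) \<in> ad_sum H {0..}" by (rule ad_sum_mult_nonneg[OF g(2)])
  moreover have "g ** matrix_inv (a ** u) = k ** ((a ** u) ** matrix_inv (a ** u))"
    by (simp only: d(4) matrix_mul_assoc)
  ultimately have "k \<in> ad_sum H {0..}" by (simp add: matrix_inv_mult(1)[OF inv])
  then have k0: "k \<in> ad_sum H {0}" using orthogonal_ad_sum_nonneg[OF H_sym] d(1) by (simp add: K_eq)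
  have ka: "k ** a \<in> ad_sum H {0}" by (rule ad_sum_mult_0[OF k0 A_0[OF d(2)]])
  then have "k ** a \<in> ad_sum H {0..}" using ad_sum_0_subset_nonneg by blast
  then have "k ** a ** (u - mat 1) \<in> ad_sum H {0<..}" by (rule ad_sum_mult_pos[OF _ N_pos[OF d(3)]])
  then show ?thesis using that d k0 ka by blast
qed

text \<open>Comparing the parts of degree 0 in g = k a u gives k a = 1. The description yields
  closure of \<open>N\<close> under products and inverses, with no recourse to the
  Campbell-Hausdorff formula.\<close>

lemma N_iff: "g \<in> N \<longleftrightarrow> g \<in> G \<and> g - mat 1 \<in> ad_sum H {0<..}"
proof
  assume g: "g \<in> G \<and> g - mat 1 \<in> ad_sum H {0<..}"
  have "g - mat 1 + mat 1 \<in> ad_sum H {0..}"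
    using g ad_sum_pos_subset_nonneg one_nonneg by (intro subspace_add[OF subspace_ad_sum]) auto
  then have g0: "g \<in> ad_sum H {0..}" by simp
  have gG: "g \<in> G" using g by blast
  obtain k a u where d0: "k \<in> K" "a \<in> A" and d: "u \<in> N" "g = k ** a ** u" and "k \<in> ad_sum H {0}"
    and d': "k ** a \<in> ad_sum H {0}" "k ** a ** (u - mat 1) \<in> ad_sum H {0<..}"
    using nonneg_decomp[OF gG g0] .
  have "k ** a - mat 1 = (g - mat 1) - k ** a ** (u - mat 1)" by (simp add: d(2) mm.diff_right)
  also have "\<dots> \<in> ad_sum H {0<..}" by (rule subspace_diff[OF subspace_ad_sum conjunct2[OF g] d'(2)])
  finally have "k ** a - mat 1 \<in> ad_sum H {0<..}" .
  moreover have "k ** a - mat 1 \<in> ad_sum H {0}"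
    using d'(1) ad_sum_0_iff[of "mat 1" H] by (simp add: subspace_diff)
  ultimately have "k ** a - mat 1 = 0" by (rule ad_sum_Int_eq_0[OF H_sym]) auto
  then show "g \<in> N" using d(1,2) by simp
qed (use N_subset_G N_pos in blast)

lemma K_transpose: "k \<in> K \<Longrightarrow> transpose k \<in> K" "k \<in> K \<Longrightarrow> matrix_inv k = transpose k"
proof -
  show inv: "matrix_inv k = transpose k" if "k \<in> K" for k
    using that by (intro matrix_inv_unique') (simp add: K_eq orthogonal_matrix_def)
  show "transpose k \<in> K" if "k \<in> K"
    using G_inv[of k] inv[OF that] that by (simp add: K_eq)
qed

text \<open>The conjugate z of \<open>a\<close> has degree 0, so its factor in \<open>N\<close>
  drops out and z = k' b. Since z is symmetric, its square is its Gram matrix \<open>b ** b\<close>.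
  Working with squares avoids uniqueness of positive square roots.\<close>

lemma conj_A_square:
  assumes k: "k \<in> K" "k \<in> ad_sum H {0}" and a: "a \<in> A"
  shows "\<exists>b\<in>A. transpose k ** (a ** a) ** k = b ** b"
proof -
  have kk: "k ** transpose k = mat 1" using k(1) by (simp add: K_eq orthogonal_matrix_def)
  define z where "z = transpose k ** a ** k"
  have zG: "z \<in> G" unfolding z_def using k(1) K_transpose(1)[OF k(1)] A_subset_G[OF a] G_mult
    by (simp add: K_eq)
  have "transpose k \<in> ad_sum H {0}" using transpose_ad_sum[OF H_sym k(2)] by simp
  then have z0: "z \<in> ad_sum H {0}" unfolding z_def using ad_sum_mult_0 A_0[OF a] k(2) by blast
  then have "z \<in> ad_sum H {0..}" using ad_sum_0_subset_nonneg by blast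
  then obtain k' b u where d: "k' \<in> K" "b \<in> A" and "u \<in> N" and zd: "z = k' ** b ** u"
    and "k' \<in> ad_sum H {0}"
    and d': "k' ** b \<in> ad_sum H {0}" "k' ** b ** (u - mat 1) \<in> ad_sum H {0<..}"
    using nonneg_decomp[OF zG] by blast
  have "k' ** b ** (u - mat 1) = z - k' ** b" by (simp add: zd mm.diff_right)
  then have "k' ** b ** (u - mat 1) \<in> ad_sum H {0}" using z0 d'(1) by (simp add: subspace_diff)
  then have "k' ** b ** (u - mat 1) = 0" by (rule ad_sum_Int_eq_0[OF H_sym _ d'(2)]) simp
  then have zkb: "z = k' ** b" by (simp add: zd mm.diff_right)
  have "transpose z = z" by (simp add: z_def matrix_transpose_mul A_sym[OF a] matrix_mul_assoc)
  then have "z ** z = transpose z ** z" by simp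
  also have "\<dots> = b ** (transpose k' ** k') ** b"
    by (simp add: zkb matrix_transpose_mul A_sym[OF d(2)] matrix_mul_assoc)
  also have "\<dots> = b ** b" using d(1) by (simp add: K_eq orthogonal_matrix_def)
  finally have "z ** z = b ** b" .
  moreover have "z ** z = transpose k ** a ** (k ** transpose k) ** a ** k"
    by (simp only: z_def matrix_mul_assoc)
  ultimately show ?thesis using d(2) kk by (simp add: matrix_mul_assoc) metis
qed

lemma unipotent_nonneg_in_N:
  assumes v: "v \<in> G" "v \<in> ad_sum H {0..}" "unipotent_mat v"
  shows "v \<in> N"
proof -
  obtain k a u where d: "k \<in> K" "a \<in> A" "u \<in> N" "v = k ** a ** u" "k \<in> ad_sum H {0}"
    "k ** a \<in> ad_sum H {0}" "k ** a ** (u - mat 1) \<in> ad_sum H {0<..}"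
    using nonneg_decomp[OF v(1,2)] .
  have "v - mat 1 = (k ** a - mat 1) + k ** a ** (u - mat 1)" by (simp add: d(4) mm.diff_right)
  then have nil: "nilpotent_mat ((k ** a - mat 1) + k ** a ** (u - mat 1))"
    using v(3) by (simp only: unipotent_mat_def)
  have ka0: "k ** a - mat 1 \<in> ad_sum H {0}"
    using d(6) ad_sum_0_iff[of "mat 1" H] by (simp add: subspace_diff)
  have uni: "unipotent_mat (k ** a)"
    unfolding unipotent_mat_def by (rule nilpotent_ad_sum_0_part[OF H_sym ka0 d(7) nil])
  \<comment> \<open>All conjugates by powers of \<open>k\<close> remain squares of elements of
    \<open>A\<close>, which gives the commutation demanded by
    \<open>unipotent_polar_trivial\<close>.\<close>
  have "\<exists>b\<in>A. mat_pow (transpose k) i ** (a ** a) ** mat_pow k i = b ** b" for i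
  proof (induction i)
    case 0
    show ?case using d(2) by auto
  next
    case (Suc i)
    then obtain b where b: "b \<in> A" "mat_pow (transpose k) i ** (a ** a) ** mat_pow k i = b ** b" by blast
    have "mat_pow (transpose k) (Suc i) ** (a ** a) ** mat_pow k (Suc i)
        = transpose k ** (mat_pow (transpose k) i ** (a ** a) ** mat_pow k i) ** k"
      unfolding mat_pow_Suc_right[of k] by (simp add: matrix_mul_assoc)
    then show ?case using conj_A_square[OF d(1,5) b(1)] b(2) by simp
  qed
  then have "(mat_pow (transpose k) i ** (a ** a) ** mat_pow k i) ** a
      = a ** (mat_pow (transpose k) i ** (a ** a) ** mat_pow k i)" for i
    using A_comm d(2) by (metis matrix_mul_assoc)
  then have "k ** a = mat 1"
    using d(1,2) uni A_subset_G G_invertible A_sym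
    by (intro unipotent_polar_trivial) (auto simp: K_eq)
  then show ?thesis using d(3,4) by simp
qed

lemma N_mult: "u \<in> N \<Longrightarrow> v \<in> N \<Longrightarrow> u ** v \<in> N"
proof -
  assume u: "u \<in> N" and v: "v \<in> N"
  have "u ** (v - mat 1) \<in> ad_sum H {0<..}"
    using ad_sum_mult_pos[OF AN_nonneg[OF A_one u] N_pos[OF v]] by simp
  then have "u ** (v - mat 1) + (u - mat 1) \<in> ad_sum H {0<..}"
    using N_pos[OF u] by (rule subspace_add[OF subspace_ad_sum])
  moreover have "u ** (v - mat 1) + (u - mat 1) = u ** v - mat 1" by (simp add: mm.diff_right)
  ultimately show ?thesis
    using N_subset_G[OF u] N_subset_G[OF v] G_mult unfolding N_iff by simp
qed

lemma N_inv: "u \<in> N \<Longrightarrow> matrix_inv u \<in> N"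
proof -
  assume u: "u \<in> N"
  have inv: "invertible u" using u N_subset_G G_invertible by blast
  have u0: "u \<in> ad_sum H {0..}" using AN_nonneg[OF A_one u] by simp
  have "matrix_inv u \<in> ad_sum H {0..}"
    by (rule ad_sum_inverse_nonneg[OF u0 inv matrix_inv_mult(2)[OF inv]])
  then have "matrix_inv u ** (u - mat 1) \<in> ad_sum H {0<..}" by (rule ad_sum_mult_pos[OF _ N_pos[OF u]])
  then have "- (matrix_inv u ** (u - mat 1)) \<in> ad_sum H {0<..}" by (rule subspace_neg[OF subspace_ad_sum])
  moreover have "- (matrix_inv u ** (u - mat 1)) = matrix_inv u - mat 1"
    by (simp add: mm.diff_right matrix_inv_mult(2)[OF inv])
  ultimately show ?thesis using u N_subset_G G_inv by (simp add: N_iff)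
qed

lemma N_unipotent: "u \<in> N \<Longrightarrow> unipotent_mat u"
  using ad_sum_pos_nilpotent[OF H_sym] N_pos by (simp add: unipotent_mat_def)

text \<open>\<open>G\<close> is closed only relative to the invertible matrices, but orthogonality
  is a closed condition that implies invertibility, so \<open>K\<close> is closed outright.\<close>

lemma compact_K: "compact K"
proof -
  obtain T where T: "closed T" "G = {g. invertible g} \<inter> T"
    using G_closed unfolding closedin_closed by blast
  have O: "orthogonal_matrix k \<Longrightarrow> invertible k" for k :: "real^'n^'n"
    by (auto simp: orthogonal_matrix_def invertible_def)
  have "K = T \<inter> {k. transpose k ** k = mat 1}"
    using O by (auto simp: K_eq T(2) orthogonal_matrix)
  moreover have "closed {k::real^'n^'n. transpose k ** k = mat 1}"
  proof (rule closed_Collect_eq)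
    have "continuous_on UNIV (transpose :: real^'n^'n \<Rightarrow> real^'n^'n)"
      by (rule linear_continuous_on) (use linear_transpose linear_conv_bounded_linear in blast)
    then show "continuous_on UNIV (\<lambda>k::real^'n^'n. transpose k ** k)"
      by (intro mm.continuous_on continuous_on_id)
  qed simp
  ultimately have "closed K" using T(1) by (simp add: closed_Int)
  moreover have "norm k \<le> norm (mat 1 :: real^'n^'n)" if "k \<in> K" for k
    using norm_orthogonal_matrix_mult[of k "mat 1"] that by (simp add: K_eq)
  then have "bounded K" unfolding bounded_iff by blast
  ultimately show ?thesis by (simp add: compact_eq_bounded_closed)
qed

theorem unipotent_subgroup_conjugate_into_N:
  assumes V: "V \<subseteq> G" "mat 1 \<in> V" "\<And>v w. v \<in> V \<Longrightarrow> w \<in> V \<Longrightarrow> v ** w \<in> V"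
    "\<And>v. v \<in> V \<Longrightarrow> matrix_inv v \<in> V" "\<And>v. v \<in> V \<Longrightarrow> unipotent_mat v"
  shows "\<exists>k\<in>K. \<forall>v\<in>V. transpose k ** v ** k \<in> N"
proof -
  let ?P = "ad_sum H {0..}"
  let ?E = "ann_chain (span ((\<lambda>v. v - mat 1) ` V))"
  obtain m where m: "?E m = UNIV" using kolchin[of V] V(3,5) by blast
  have "\<exists>k\<in>K. \<forall>v\<in>V. \<forall>y\<in>?P. v ** (k ** y) \<in> (**) k ` ?P"
  proof (rule unipotent_fixed_subspace[OF subspace_ad_sum compact_K _ _ subspace_ann_chain _ m ann_chain_Suc_mono V(2)])
    show "K \<noteq> {}" using K_one by blast
    show "\<exists>w\<in>V. w ** v = mat 1" if "v \<in> V" for v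
      using V(1,4) that matrix_inv_mult(2)[OF G_invertible] by blast
    show "(v - mat 1) ** Y \<in> ?E i" if "v \<in> V" "Y \<in> ?E (Suc i)" for v Y i
      using that by (auto intro: span_base)
    show "\<exists>k'\<in>K. (**) (v ** k) ` ?P = (**) k' ` ?P" if "v \<in> V" "k \<in> K" for v k
    proof -
      have "v ** k \<in> G" using that V(1) G_mult by (auto simp: K_eq)
      then obtain k' a u where d: "k' \<in> K" "a \<in> A" "u \<in> N" "v ** k = k' ** a ** u" using KAN by blast
      have inv: "invertible (a ** u)" using d A_subset_G N_subset_G G_mult G_invertible by blast
      \<comment> \<open>Left multiplication by the unit a u maps \<open>?P\<close> onto itself, so
        the subspace moved by \<open>v\<close> depends only on the factor k'.\<close>
      have g: "a ** u \<in> ?P" by (rule AN_nonneg[OF d(2,3)])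
      have gi: "matrix_inv (a ** u) \<in> ?P"
        by (rule ad_sum_inverse_nonneg[OF g inv matrix_inv_mult(2)[OF inv]])
      have "(**) (a ** u) ` ?P = ?P"
      proof (intro equalityI subsetI)
        fix Y assume "Y \<in> ?P"
        then have "matrix_inv (a ** u) ** Y \<in> ?P" by (rule ad_sum_mult_nonneg[OF gi])
        moreover have "Y = (a ** u) ** (matrix_inv (a ** u) ** Y)"
          by (simp only: matrix_mul_assoc[of "a ** u"] matrix_inv_mult(1)[OF inv] matrix_mul_lid)
        ultimately show "Y \<in> (**) (a ** u) ` ?P" by blast
      qed (use ad_sum_mult_nonneg[OF g] in blast)
      then have "(**) k' ` ?P = (**) k' ` (**) (a ** u) ` ?P" by simp
      also have "\<dots> = (**) (v ** k) ` ?P" by (simp only: d(4) image_image matrix_mul_assoc)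
      finally show ?thesis using d(1) by metis
    qed
  qed (use V in \<open>auto simp: K_eq\<close>)
  then obtain k where k: "k \<in> K" "\<And>v y. v \<in> V \<Longrightarrow> y \<in> ?P \<Longrightarrow> v ** (k ** y) \<in> (**) k ` ?P" by blast
  have kk: "transpose k ** k = mat 1" "k ** transpose k = mat 1"
    using k(1) by (auto simp: K_eq orthogonal_matrix_def)
  have "transpose k ** v ** k \<in> N" if v: "v \<in> V" for v
  proof (rule unipotent_nonneg_in_N)
    show "transpose k ** v ** k \<in> G"
      using k(1) K_transpose(1)[OF k(1)] v V(1) G_mult by (auto simp: K_eq)
    \<comment> \<open>Stability of the subspace is applied to the identity, an element of
      \<open>?P\<close>: this places the conjugate of \<open>v\<close> itself in
      \<open>?P\<close>.\<close>
    obtain p where p: "p \<in> ?P" "v ** (k ** mat 1) = k ** p" using k(2)[OF v one_nonneg] by blast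
    then have "transpose k ** v ** k = (transpose k ** k) ** p" by (simp add: matrix_mul_assoc[symmetric])
    then show "transpose k ** v ** k \<in> ?P" using p(1) by (simp add: kk)
    have "transpose k ** (v - mat 1) ** k = transpose k ** v ** k - mat 1"
      by (simp add: mm.diff_left mm.diff_right kk)
    then show "unipotent_mat (transpose k ** v ** k)"
      using V(5)[OF v] mat_pow_conj[of k "transpose k" "v - mat 1"] kk
      unfolding unipotent_mat_def nilpotent_mat_def by (metis times0_left times0_right)
  qed
  then show ?thesis using k(1) by blast
qed

end

section \<open>Matrix groups and conjugation\<close>

lemma GL_group_simps [simp]:
  "carrier GL_group = {A::'a::field^'n^'n. invertible A}"
  "mult GL_group = ((**) :: 'a^'n^'n \<Rightarrow> _)" "one GL_group = (mat 1 :: 'a^'n^'n)"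
  by (simp_all add: GL_group_def)

lemma group_GL_group: "group (GL_group :: (real^'n^'n) monoid)"
proof (rule groupI)
  show "\<exists>y\<in>carrier GL_group. y \<otimes>\<^bsub>GL_group\<^esub> x = \<one>\<^bsub>GL_group\<^esub>"
    if "x \<in> carrier GL_group" for x :: "real^'n^'n"
    using that matrix_inv_mult[of x] by (auto simp: invertible_def)
qed (auto simp: invertible_mult matrix_mul_assoc, auto simp: invertible_def intro!: exI[of _ "mat 1"])

lemma inv_GL_group:
  assumes "invertible (x::real^'n^'n)"
  shows "inv\<^bsub>GL_group\<^esub> x = matrix_inv x"
proof (rule group.inv_equality[OF group_GL_group])
  show "matrix_inv x \<in> carrier GL_group" using matrix_inv_unique'(3) matrix_inv_mult(1)[OF assms] by simp
qed (use matrix_inv_mult[OF assms] assms in auto)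

lemma subgroup_GL_group_iff:
  fixes G :: "(real^'n^'n) set"
  shows "subgroup G GL_group \<longleftrightarrow> (\<forall>g\<in>G. invertible g) \<and> mat 1 \<in> G \<and>
    (\<forall>g\<in>G. \<forall>h\<in>G. g ** h \<in> G) \<and> (\<forall>g\<in>G. matrix_inv g \<in> G)"
  unfolding subgroup_def by (auto simp: inv_GL_group subset_iff)

lemma invertible_matrix_inv: "invertible (g::real^'n^'n) \<Longrightarrow> invertible (matrix_inv g)"
  using matrix_inv_mult(1) matrix_inv_unique'(3) by blast

lemma matrix_inv_matrix_inv: "invertible (g::real^'n^'n) \<Longrightarrow> matrix_inv (matrix_inv g) = g"
  using matrix_inv_mult(2) matrix_inv_unique'(1) by blast

lemma matrix_inv_product:
  fixes g h :: "real^'n^'n"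
  assumes "invertible g" "invertible h"
  shows "matrix_inv (g ** h) = matrix_inv h ** matrix_inv g"
proof (rule matrix_inv_unique'(1))
  have "g ** h ** (matrix_inv h ** matrix_inv g) = g ** (h ** matrix_inv h) ** matrix_inv g"
    by (simp only: matrix_mul_assoc)
  then show "g ** h ** (matrix_inv h ** matrix_inv g) = mat 1"
    using assms by (simp add: matrix_inv_mult)
qed

lemma conj_set_comp:
  fixes g h :: "real^'n^'n"
  assumes "invertible g" "invertible h"
  shows "conj_set g (conj_set h S) = conj_set (g ** h) S"
  unfolding conj_set_def image_image by (simp add: matrix_inv_product[OF assms] matrix_mul_assoc)

lemma conj_set_one: "conj_set (mat 1) S = (S :: (real^'n^'n) set)"
proof -
  have "matrix_inv (mat 1 :: real^'n^'n) = mat 1" by (rule matrix_inv_unique') simp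
  then show ?thesis by (simp add: conj_set_def)
qed

lemma conj_set_inverse:
  fixes g :: "real^'n^'n"
  assumes "invertible g"
  shows "conj_set (matrix_inv g) (conj_set g S) = S" "conj_set g (conj_set (matrix_inv g) S) = S"
  using assms by (simp_all add: conj_set_comp invertible_matrix_inv matrix_inv_mult conj_set_one)

lemma conj_set_mono: "S \<subseteq> T \<Longrightarrow> conj_set g S \<subseteq> conj_set g T"
  unfolding conj_set_def by (rule image_mono)

lemma conj_mult:
  fixes g :: "real^'n^'n"
  assumes "invertible g"
  shows "(g ** x ** matrix_inv g) ** (g ** y ** matrix_inv g) = g ** (x ** y) ** matrix_inv g"
proof -
  have "(g ** x ** matrix_inv g) ** (g ** y ** matrix_inv g) = g ** x ** (matrix_inv g ** g) ** y ** matrix_inv g"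
    by (simp only: matrix_mul_assoc)
  then show ?thesis using assms by (simp add: matrix_inv_mult matrix_mul_assoc)
qed

lemma matrix_inv_conj:
  fixes g :: "real^'n^'n"
  assumes "invertible g" "invertible x"
  shows "matrix_inv (g ** x ** matrix_inv g) = g ** matrix_inv x ** matrix_inv g"
  by (rule matrix_inv_unique') (simp add: conj_mult assms matrix_inv_mult)

lemma subgroup_conj_set:
  fixes g :: "real^'n^'n"
  assumes g: "invertible g" and G: "subgroup G GL_group"
  shows "subgroup (conj_set g G) GL_group"
  unfolding subgroup_GL_group_iff
proof (intro conjI ballI)
  note G' = G[unfolded subgroup_GL_group_iff]
  show "invertible x" if "x \<in> conj_set g G" for x
    using that G' g unfolding conj_set_def by (auto intro!: invertible_mult invertible_matrix_inv)
  have "g ** mat 1 ** matrix_inv g = mat 1" using g by (simp add: matrix_inv_mult)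
  then show "mat 1 \<in> conj_set g G" using G' unfolding conj_set_def by force
  show "x ** y \<in> conj_set g G" if "x \<in> conj_set g G" "y \<in> conj_set g G" for x y
    using that G' unfolding conj_set_def by (auto simp: conj_mult[OF g])
  show "matrix_inv x \<in> conj_set g G" if "x \<in> conj_set g G" for x
    using that G' unfolding conj_set_def by (auto simp: matrix_inv_conj[OF g])
qed

lemma conj_set_member:
  fixes g :: "real^'n^'n"
  assumes "subgroup G GL_group" "g \<in> G"
  shows "conj_set g G = G"
proof -
  note G = assms(1)[unfolded subgroup_GL_group_iff]
  have sub: "conj_set h G \<subseteq> G" if "h \<in> G" for h using that G by (auto simp: conj_set_def)
  have "G = conj_set g (conj_set (matrix_inv g) G)" using conj_set_inverse(2) G assms(2) by metis
  also have "\<dots> \<subseteq> conj_set g G" using sub G assms(2) by (intro conj_set_mono) blast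
  finally show ?thesis using sub[OF assms(2)] by blast
qed

lemma unipotent_conj:
  fixes g :: "real^'n^'n"
  assumes g: "invertible g" and "unipotent_mat x"
  shows "unipotent_mat (g ** x ** matrix_inv g)"
proof -
  have "g ** x ** matrix_inv g - mat 1 = g ** (x - mat 1) ** matrix_inv g"
    by (simp add: mm.diff_left mm.diff_right matrix_inv_mult[OF g])
  then show ?thesis
    using assms(2) mat_pow_conj[OF matrix_inv_mult(2,1)[OF g], of "x - mat 1"]
    unfolding unipotent_mat_def nilpotent_mat_def by (metis times0_left times0_right)
qed

lemma unipotent_subgroup_conj_set:
  fixes g :: "real^'n^'n"
  assumes "invertible g" "unipotent_subgroup G V"
  shows "unipotent_subgroup (conj_set g G) (conj_set g V)"
  using assms subgroup_conj_set conj_set_mono unipotent_conj[OF assms(1)]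
  unfolding unipotent_subgroup_def by (auto simp: conj_set_def)

lemma closedin_conj_set:
  fixes g :: "real^'n^'n"
  assumes g: "invertible g" and G: "closedin (top_of_set {x. invertible x}) G"
  shows "closedin (top_of_set {x. invertible x}) (conj_set g G)"
proof -
  obtain T where T: "closed T" "G = {x. invertible x} \<inter> T"
    using G unfolding closedin_closed by blast
  have inv2: "invertible (g ** x ** matrix_inv g)" if "invertible x" for x
    using that g by (intro invertible_mult invertible_matrix_inv)
  have cc: "matrix_inv g ** (g ** x ** matrix_inv g) ** g = x" for x
  proof -
    have "matrix_inv g ** (g ** x ** matrix_inv g) ** g = (matrix_inv g ** g) ** x ** (matrix_inv g ** g)"
      by (simp only: matrix_mul_assoc)
    then show ?thesis by (simp add: matrix_inv_mult[OF g])
  qed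
  have cc': "g ** (matrix_inv g ** x ** g) ** matrix_inv g = x" for x
  proof -
    have "g ** (matrix_inv g ** x ** g) ** matrix_inv g = (g ** matrix_inv g) ** x ** (g ** matrix_inv g)"
      by (simp only: matrix_mul_assoc)
    then show ?thesis by (simp add: matrix_inv_mult[OF g])
  qed
  have "conj_set g G = {x. invertible x} \<inter> {x. matrix_inv g ** x ** g \<in> T}"
  proof (intro equalityI subsetI)
    fix x assume "x \<in> conj_set g G"
    then show "x \<in> {x. invertible x} \<inter> {x. matrix_inv g ** x ** g \<in> T}"
      using T(2) inv2 cc by (auto simp: conj_set_def)
  next
    fix x assume x: "x \<in> {x. invertible x} \<inter> {x. matrix_inv g ** x ** g \<in> T}"
    then have "invertible (matrix_inv g ** x ** g)"
      using g by (intro invertible_mult invertible_matrix_inv) auto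
    then have "matrix_inv g ** x ** g \<in> G" using T(2) x by blast
    then show "x \<in> conj_set g G" unfolding conj_set_def using cc'[of x] by (metis image_eqI)
  qed
  moreover have "closed {x. matrix_inv g ** x ** g \<in> T}"
  proof -
    have "continuous_on UNIV (\<lambda>x. matrix_inv g ** x ** g)"
      by (intro mm.continuous_on continuous_on_id continuous_on_const)
    from closed_vimage[OF T(1) this] show ?thesis by (simp add: vimage_def)
  qed
  ultimately show ?thesis unfolding closedin_closed by blast
qed

text \<open>The matrices that lower every term of Engel's chain form a nilpotent associative algebra
  \<open>S\<close> containing \<open>\<uu>\<close>. Exponentials of elements of \<open>\<uu>\<close>
  lie in 1 + \<open>S\<close>, whose invertible elements are closed under products and
  inverses.\<close>

lemma unipotent_connected_subgroup:
  fixes G \<uu> :: "(real^'n^'n) set"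
  assumes G: "subgroup G GL_group" and u: "lie_subalgebra \<uu> (Lie G)"
    and nil: "\<And>X. X \<in> \<uu> \<Longrightarrow> nilpotent_mat X"
  shows "unipotent_subgroup G (connected_subgroup \<uu>)"
proof -
  note G' = G[unfolded subgroup_GL_group_iff]
  have expG: "mat_exp X \<in> G" if "X \<in> \<uu>" for X
  proof -
    have "\<forall>t::real. mat_exp (t *\<^sub>R X) \<in> G" using that u by (auto simp: lie_subalgebra_def Lie_def)
    from spec[OF this, of 1] show ?thesis by simp
  qed
  obtain m where m: "ann_chain \<uu> m = UNIV"
    using engel[of \<uu>] u nil unfolding lie_subalgebra_def lie_bracket_def by blast
  let ?E = "ann_chain \<uu>"
  define S where "S = {Z. \<forall>i. \<forall>Y\<in>?E (Suc i). Z ** Y \<in> ?E i}"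
  have SD: "Z ** Y \<in> ?E i" if "Z \<in> S" "Y \<in> ?E (Suc i)" for Z Y i using that by (auto simp: S_def)
  have subS: "subspace S"
    unfolding S_def using subspace_ann_chain[of \<uu>]
    by (auto simp: subspace_def mm.add_left mm.scaleR_left)
  have multS: "Z ** W \<in> S" if "Z \<in> S" "W \<in> S" for Z W
  proof -
    have "(Z ** W) ** Y \<in> ?E i" if "Y \<in> ?E (Suc i)" for Y i
    proof -
      have "Z ** (W ** Y) \<in> ?E i"
        using SD[OF \<open>Z \<in> S\<close>] SD[OF \<open>W \<in> S\<close> that] ann_chain_Suc_mono[of \<uu> i] by blast
      then show ?thesis by (simp add: matrix_mul_assoc)
    qed
    then show ?thesis by (auto simp: S_def)
  qed
  have nilS: "nilpotent_mat Z" if "Z \<in> S" for Z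
  proof -
    have "mat_pow Z j ** Y \<in> ?E i" if "Y \<in> ?E (i + j)" for Y i j
      using that
    proof (induction j arbitrary: Y)
      case (Suc j)
      have "Z ** Y \<in> ?E (i + j)" using SD[OF \<open>Z \<in> S\<close>] Suc.prems by simp
      then have "mat_pow Z j ** (Z ** Y) \<in> ?E i" by (rule Suc.IH)
      then show ?case unfolding mat_pow_Suc_right by (simp add: matrix_mul_assoc)
    qed simp
    from this[of "mat 1" 0 m] have "mat_pow Z m = 0" using m by simp
    then show ?thesis by (auto simp: nilpotent_mat_def)
  qed
  have expS: "mat_exp X - mat 1 \<in> S" if "X \<in> \<uu>" for X
  proof (rule mat_exp_minus_one_mem[OF subS])
    have X: "X \<in> S" using that by (auto simp: S_def)
    show "mat_pow X (Suc k) \<in> S" for k by (induction k) (use X multS in auto)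
  qed
  have invS: "matrix_inv g - mat 1 \<in> S" if g: "invertible g" "g - mat 1 \<in> S" for g
  proof -
    have "(matrix_inv g - mat 1) ** Y \<in> ?E i" if Y: "Y \<in> ?E (Suc i)" for Y i
    proof -
      have gE: "g ** Z \<in> ?E i" if "Z \<in> ?E i" for Z
      proof -
        have "(g - mat 1) ** Z \<in> ?E i" using SD[OF g(2)] that ann_chain_Suc_mono by blast
        then have "(g - mat 1) ** Z + Z \<in> ?E i" using that by (rule subspace_add[OF subspace_ann_chain])
        then show ?thesis by (simp add: mm.diff_left)
      qed
      have "matrix_inv g ** ((g - mat 1) ** Y) \<in> ?E i"
        by (rule inverse_preserves_subspace[OF subspace_ann_chain g(1) gE matrix_inv_mult(2)[OF g(1)] SD[OF g(2) Y]])
      then have "- (matrix_inv g ** ((g - mat 1) ** Y)) \<in> ?E i" by (rule subspace_neg[OF subspace_ann_chain])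
      moreover have "- (matrix_inv g ** ((g - mat 1) ** Y)) = (matrix_inv g - mat 1) ** Y"
        by (simp add: mm.diff_left mm.diff_right matrix_mul_assoc matrix_inv_mult(2)[OF g(1)])
      ultimately show ?thesis by simp
    qed
    then show ?thesis by (auto simp: S_def)
  qed
  have expGL: "mat_exp ` \<uu> \<subseteq> carrier GL_group" using expG G' by auto
  have "g \<in> G \<and> g - mat 1 \<in> S" if "g \<in> connected_subgroup \<uu>" for g
    using that unfolding connected_subgroup_def
  proof (induction rule: generate.induct)
    case one
    then show ?case using G' subS by (simp add: subspace_0)
  next
    case (incl h)
    then show ?case using expG expS by auto
  next
    case (inv h)
    then show ?case using expG expS invS G' by (auto simp: inv_GL_group)
  next
    case (eng h1 h2)
    have "(h1 - mat 1) ** (h2 - mat 1) + (h1 - mat 1) + (h2 - mat 1) \<in> S"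
      using eng by (intro subspace_add[OF subS] multS) auto
    moreover have "(h1 - mat 1) ** (h2 - mat 1) + (h1 - mat 1) + (h2 - mat 1) = h1 ** h2 - mat 1"
      by (simp add: mm.diff_left mm.diff_right)
    ultimately show ?case using eng G' by simp
  qed
  moreover have "subgroup (connected_subgroup \<uu>) GL_group"
    unfolding connected_subgroup_def by (rule group.generate_is_subgroup[OF group_GL_group expGL])
  ultimately show ?thesis
    unfolding unipotent_subgroup_def unipotent_mat_def using nilS by blast
qed

section \<open>Conjugacy into the nilpotent factor\<close>

text \<open>A root space for a positive root \<alpha> lies in the eigenspace of the bracket with
  \<open>H\<close> for the eigenvalue \<alpha> H. Positive degrees are preserved by powers, so
  exponentials from the span lie in 1 plus positive degree.\<close>

lemma Iwasawa_self_adjoint_kan: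
  fixes G K A N :: "(real^'n^'n) set"
  assumes G: "subgroup G GL_group" "closedin (top_of_set (carrier GL_group)) G"
    and I: "Iwasawa_self_adjoint G K A N"
  shows "\<exists>H. iwasawa_kan G K A N H"
proof -
  note G' = G(1)[unfolded subgroup_GL_group_iff]
  from I obtain \<aa> P where K: "K = G \<inter> {x. orthogonal_matrix x}"
    and a: "maximal_abelian_in {X \<in> Lie G. transpose X = X} \<aa>" "A = mat_exp ` \<aa>"
    and P: "positive_restricted_roots (Lie G) \<aa> P"
    and N: "N = mat_exp ` span (\<Union>\<alpha>\<in>P. root_space (Lie G) \<aa> \<alpha>)"
    and KAN: "G = {k ** x ** u | k x u. k \<in> K \<and> x \<in> A \<and> u \<in> N}"
    unfolding Iwasawa_self_adjoint_def by blast
  have sub: "subspace \<aa>" and comm: "\<And>X Y. X \<in> \<aa> \<Longrightarrow> Y \<in> \<aa> \<Longrightarrow> X ** Y = Y ** X"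
    and sym: "\<And>X. X \<in> \<aa> \<Longrightarrow> transpose X = X"
    using a(1) unfolding maximal_abelian_in_def abelian_subspace_def lie_bracket_def by auto
  obtain H where H: "H \<in> \<aa>" and Ppos: "\<And>\<alpha>. \<alpha> \<in> P \<Longrightarrow> \<alpha> H > 0"
    using P unfolding positive_restricted_roots_def by blast
  have span_pos: "span (\<Union>\<alpha>\<in>P. root_space (Lie G) \<aa> \<alpha>) \<subseteq> ad_sum H {0<..}"
  proof (rule span_minimal[OF _ subspace_ad_sum], rule subsetI)
    fix X assume "X \<in> (\<Union>\<alpha>\<in>P. root_space (Lie G) \<aa> \<alpha>)"
    then obtain \<alpha> where \<alpha>: "\<alpha> \<in> P" "lie_bracket H X = \<alpha> H *\<^sub>R X"
      using H by (auto simp: root_space_def)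
    then show "X \<in> ad_sum H {0<..}"
      by (intro ad_space_subset_ad_sum[of "\<alpha> H"]) (simp_all add: Ppos ad_space_def lie_bracket_def)
  qed
  have "iwasawa_kan G K A N H"
  proof
    show "transpose H = H" using sym H .
    show "closedin (top_of_set {g. invertible g}) G" using G(2) by simp
    show "mat 1 \<in> A" unfolding a(2) using mat_exp_0 subspace_0[OF sub] by (metis image_eqI)
    show "mat 1 \<in> N" unfolding N using mat_exp_0 span_0 by (metis image_eqI)
    show "transpose x = x" if "x \<in> A" for x
      using that transpose_mat_exp sym by (auto simp: a(2))
    show "H ** x = x ** H" if "x \<in> A" for x
      using that mat_exp_commute[OF comm[OF _ H]] by (auto simp: a(2))
    show "x ** y = y ** x" if xy: "x \<in> A" "y \<in> A" for x y
    proof -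
      obtain X Y where X: "X \<in> \<aa>" "x = mat_exp X" and Y: "Y \<in> \<aa>" "y = mat_exp Y"
        using xy a(2) by blast
      have "mat_exp Y ** X = X ** mat_exp Y" by (rule mat_exp_commute[OF comm[OF Y(1) X(1)]])
      then show ?thesis unfolding X(2) Y(2) by (intro mat_exp_commute) simp
    qed
    show "u - mat 1 \<in> ad_sum H {0<..}" if u: "u \<in> N" for u
    proof -
      obtain X where X: "X \<in> ad_sum H {0<..}" "u = mat_exp X" using u N span_pos by blast
      show ?thesis unfolding X(2)
        by (rule mat_exp_minus_one_mem[OF subspace_ad_sum ad_sum_pos_pow[OF X(1)]])
    qed
    show "K = G \<inter> {k. orthogonal_matrix k}" by (rule K)
    show "G = {k ** x ** u | k x u. k \<in> K \<and> x \<in> A \<and> u \<in> N}" by (rule KAN)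
  qed (use G' in auto)
  then show ?thesis by blast
qed

lemma (in iwasawa_kan) unipotent_subgroup_N: "unipotent_subgroup G N"
  unfolding unipotent_subgroup_def subgroup_GL_group_iff
  using N_one N_mult N_inv N_unipotent N_subset_G G_invertible by blast

lemma (in iwasawa_kan) unipotent_subgroup_conj_subset_N:
  assumes "unipotent_subgroup G V"
  shows "\<exists>g\<in>G. conj_set (matrix_inv g) V \<subseteq> N"
proof -
  have "\<exists>k\<in>K. \<forall>v\<in>V. transpose k ** v ** k \<in> N"
    by (rule unipotent_subgroup_conjugate_into_N)
      (use assms in \<open>auto simp: unipotent_subgroup_def subgroup_GL_group_iff\<close>)
  then obtain k where k: "k \<in> K" "\<And>v. v \<in> V \<Longrightarrow> transpose k ** v ** k \<in> N" by blast
  have "k \<in> G" using k(1) by (simp add: K_eq)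
  then have "matrix_inv (matrix_inv k) = k" by (intro matrix_inv_matrix_inv G_invertible)
  then have "conj_set (matrix_inv k) V \<subseteq> N"
    using k K_transpose(2)[OF k(1)] by (auto simp: conj_set_def)
  then show ?thesis using \<open>k \<in> G\<close> by blast
qed

text \<open>Everything is transported along the matrix \<open>h\<close> that makes the group stable
  under transposition; the conjugating element found there has the form
  \<open>h ** g ** matrix_inv h\<close> with g in \<open>G\<close>.\<close>

lemma Iwasawa_conjugacy:
  fixes G K A N :: "(real^'n^'n) set"
  assumes G: "subgroup G GL_group" "closedin (top_of_set (carrier GL_group)) G"
    and I: "Iwasawa_decomposition G K A N"
  shows "unipotent_subgroup G N"
    and "\<And>V. unipotent_subgroup G V \<Longrightarrow> \<exists>g\<in>G. conj_set (matrix_inv g) V \<subseteq> N"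
proof -
  obtain h where h: "invertible h"
    "Iwasawa_self_adjoint (conj_set h G) (conj_set h K) (conj_set h A) (conj_set h N)"
    using I unfolding Iwasawa_decomposition_def by blast
  have "subgroup (conj_set h G) GL_group" "closedin (top_of_set (carrier GL_group)) (conj_set h G)"
    using subgroup_conj_set[OF h(1) G(1)] closedin_conj_set[OF h(1)] G(2) by auto
  then obtain H where "iwasawa_kan (conj_set h G) (conj_set h K) (conj_set h A) (conj_set h N) H"
    using Iwasawa_self_adjoint_kan h(2) by blast
  then interpret iwasawa_kan "conj_set h G" "conj_set h K" "conj_set h A" "conj_set h N" H .
  note hi = invertible_matrix_inv[OF h(1)]
  show "unipotent_subgroup G N"
    using unipotent_subgroup_conj_set[OF hi unipotent_subgroup_N] by (simp add: conj_set_inverse[OF h(1)])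
  fix V assume "unipotent_subgroup G V"
  from unipotent_subgroup_conj_subset_N[OF unipotent_subgroup_conj_set[OF h(1) this]]
  obtain g where g: "g \<in> G" "conj_set (matrix_inv (h ** g ** matrix_inv h)) (conj_set h V) \<subseteq> conj_set h N"
    unfolding conj_set_def[of h G] by blast
  have ginv: "invertible g" using G(1) g(1) by (simp add: subgroup_GL_group_iff)
  have "conj_set (matrix_inv (h ** g ** matrix_inv h)) (conj_set h V) = conj_set (h ** matrix_inv g) V"
  proof -
    have "h ** matrix_inv g ** matrix_inv h ** h = h ** matrix_inv g ** (matrix_inv h ** h)"
      by (simp only: matrix_mul_assoc)
    also have "\<dots> = h ** matrix_inv g" by (simp add: matrix_inv_mult[OF h(1)])
    finally show ?thesis
      using h(1) ginv hi
      by (simp add: matrix_inv_conj conj_set_comp invertible_mult invertible_matrix_inv)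
  qed
  also have "\<dots> = conj_set h (conj_set (matrix_inv g) V)"
    using h(1) ginv by (simp add: conj_set_comp invertible_matrix_inv)
  finally have "conj_set (matrix_inv h) (conj_set h (conj_set (matrix_inv g) V)) \<subseteq> conj_set (matrix_inv h) (conj_set h N)"
    using g(2) by (simp only: conj_set_mono)
  then show "\<exists>g\<in>G. conj_set (matrix_inv g) V \<subseteq> N"
    using g(1) by (auto simp: conj_set_inverse[OF h(1)])
qed

text \<open>The conjugate of \<open>N\<close> by \<open>g\<close> is itself a unipotent subgroup of
  \<open>G\<close> and contains \<open>V\<close>, so maximality gives equality.\<close>

lemma maximal_unipotent_subgroup_eq_conj:
  fixes G N V :: "(real^'n^'n) set"
  assumes G: "subgroup G GL_group" and N: "unipotent_subgroup G N"
    and V: "maximal_unipotent_subgroup G V" and g: "g \<in> G" "conj_set (matrix_inv g) V \<subseteq> N"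
  shows "V = conj_set g N"
proof -
  have ginv: "invertible g" using G g(1) by (simp add: subgroup_GL_group_iff)
  have "conj_set g (conj_set (matrix_inv g) V) \<subseteq> conj_set g N" using g(2) by (rule conj_set_mono)
  then have "V \<subseteq> conj_set g N" by (simp add: conj_set_inverse[OF ginv])
  moreover have "unipotent_subgroup G (conj_set g N)"
    using unipotent_subgroup_conj_set[OF ginv N] conj_set_member[OF G g(1)] by simp
  ultimately show ?thesis using V unfolding maximal_unipotent_subgroup_def by blast
qed

theorem mainTheorem2:
  fixes G K A N :: "(real ^ 'n ^ 'n) set"
  assumes "real_algebraic_group G"
    and "reductive_real_group G"
    and "Iwasawa_decomposition G K A N"
  shows "(\<forall>\<uu> U. lie_subalgebra \<uu> (Lie G) \<and> (\<forall>X\<in>\<uu>. nilpotent_mat X) \<and>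
              U = connected_subgroup \<uu> \<longrightarrow>
              (\<exists>g\<in>G. conj_set (matrix_inv g) U \<subseteq> N)) \<and>
         (\<forall>V W. maximal_unipotent_subgroup G V \<and> maximal_unipotent_subgroup G W \<longrightarrow>
              (\<exists>g\<in>G. W = conj_set g V))"
proof -
  have G: "subgroup G GL_group" and closed: "closedin (top_of_set (carrier GL_group)) G"
    using assms(1) unfolding real_algebraic_group_def by auto
  note G' = G[unfolded subgroup_GL_group_iff]
  note conj = Iwasawa_conjugacy[OF G closed assms(3)]
  have "\<exists>g\<in>G. conj_set (matrix_inv g) (connected_subgroup \<uu>) \<subseteq> N"
    if "lie_subalgebra \<uu> (Lie G)" "\<forall>X\<in>\<uu>. nilpotent_mat X" for \<uu>
    using that by (intro conj(2) unipotent_connected_subgroup[OF G]) auto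
  moreover have "\<exists>g\<in>G. W = conj_set g V"
    if V: "maximal_unipotent_subgroup G V" and W: "maximal_unipotent_subgroup G W" for V W
  proof -
    obtain g where g: "g \<in> G" "V = conj_set g N"
      using conj(2)[of V] maximal_unipotent_subgroup_eq_conj[OF G conj(1) V] V
      unfolding maximal_unipotent_subgroup_def by blast
    obtain g' where g': "g' \<in> G" "W = conj_set g' N"
      using conj(2)[of W] maximal_unipotent_subgroup_eq_conj[OF G conj(1) W] W
      unfolding maximal_unipotent_subgroup_def by blast
    have inv: "invertible g" "invertible g'" "invertible (matrix_inv g)"
      using G' g(1) g'(1) by auto
    have "conj_set (g' ** matrix_inv g) V = conj_set g' (conj_set (matrix_inv g) V)"
      using inv by (simp add: conj_set_comp)
    also have "\<dots> = W" by (simp add: g(2) g'(2) conj_set_inverse[OF inv(1)])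
    finally show ?thesis using G' g(1) g'(1) by metis
  qed
  ultimately show ?thesis by blast
qed

end
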